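(* Let $\beta>0$, $\gamma\in(0,1)$, and let $\mathsf T$ be a fixed directed rooted tree on $a+1$ nodes ($a\ge 1$) with root $\mathsf r$, all edges directed towards $\mathsf r$, with leaves $v_1,\dots,v_\ell$, and let $m_1,\dots,m_\ell$ be as defined in the context. Put $m:=\sum_{i=1}^\ell m_i$. Then there is a constant $C>0$, independent of $u$, such that $$\mu(u)\sim C\,u^{-\ell\gamma}(\log u^{-1})^m\qquad\text{as } u\to 0,$$ i.e. the ratio of the two sides tends to $1$. Furthermore, $\mu(u)$ is increasing as $u\downarrow 0$ (i.e. $u\mapsto\mu(u)$ is decreasing in $u$).
   Context: Age-dependent random connection model $\mathsf{AD}(\beta,\gamma)$: let $\mathcal P$ be a homogeneous Poisson point process with unit intensity on $\mathbb T:=\mathbb R\times[0,1]$. The vertex set is $\mathcal P$. For two vertices $(x,u),(y,v)$ with $u\le v$, there is a directed edge from $(y,v)$ to $(x,u)$, written $(y,v)\to(x,u)$, if and only if $|x-y|\le\beta u^{-\gamma}v^{\gamma-1}$. Sub-tree counts: let $\mathsf T$ be a directed tree with root $\mathsf r$, whose edges are all directed towards $\mathsf r$ (along the path from each node to the root). For $(x,u)\in\mathbb T$, $\mathcal D_{\mathsf{in}}(x,u)$ is the number of injective graph homomorphisms from $\mathsf T$ to the model (with $(x,u)$ added to the vertex set if it is not in $\mathcal P$) mapping $\mathsf r$ to $(x,u)$; that is, the number of injective maps $f$ from the nodes of $\mathsf T$ to $\mathcal P\cup\{(x,u)\}$ with $f(\mathsf r)=(x,u)$ and $f(i)\to f(j)$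 for every edge $i\to j$ of $\mathsf T$. Write $\mathcal D_{\mathsf{in}}(u)=\mathcal D_{\mathsf{in}}(0,u)$ and $\mu(u):=\mathbb E[\mathcal D_{\mathsf{in}}(x,u)]$, which does not depend on $x$. The leaves $v_1,\dots,v_\ell$ of $\mathsf T$ are the nodes with no further children. For each $i$, $m_i$ is the number of nodes strictly between $v_i$ and the nearest intersection node on the path from $v_i$ to $\mathsf r$, i.e. the first node on that path at which it merges with a path beginning at another leaf (excluding both $v_i$ and the intersection node). If the path beginning at $v_i$ does not merge with other paths before reaching $\mathsf r$, then $m_i$ is the number of nodes strictly between $v_i$ and $\mathsf r$. *)

theory Defs
  imports "HOL-Probability.Probability" "HOL-Library.Landau_Symbols"
begin

section \<open>Homogeneous Poisson point processes\<close>

text \<open>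
  The process is modelled as a random locally finite set of points (it is simple); its number of
  points in a bounded set is therefore a genuine cardinality. \<^const>\<open>poisson_pmf\<close>
  is only specified for positive rates, so null sets are treated separately.
  Independence of finite families follows from \<^term>\<open>count_indep\<close> by padding with empty sets.
\<close>

locale unit_poisson_process = prob_space M for M :: "'w measure" +
  fixes S :: "'p::euclidean_space set" and P :: "'w \<Rightarrow> 'p set"
  assumes points_in: "\<omega> \<in> space M \<Longrightarrow> P \<omega> \<subseteq> S"
    and locally_finite: "\<omega> \<in> space M \<Longrightarrow> bounded B \<Longrightarrow> finite (P \<omega> \<inter> B)"
    and count_measurable: "B \<in> sets borel \<Longrightarrow> bounded B \<Longrightarrow> B \<subseteq> S \<Longrightarrow>
          (\<lambda>\<omega>. card (P \<omega> \<inter> B)) \<in> measurable M (count_space UNIV)"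
    and count_poisson: "B \<in> sets borel \<Longrightarrow> bounded B \<Longrightarrow> B \<subseteq> S \<Longrightarrow> measure lborel B > 0 \<Longrightarrow>
          distr M (count_space UNIV) (\<lambda>\<omega>. card (P \<omega> \<inter> B)) = measure_pmf (poisson_pmf (measure lborel B))"
    and count_null: "B \<in> sets borel \<Longrightarrow> bounded B \<Longrightarrow> B \<subseteq> S \<Longrightarrow> measure lborel B = 0 \<Longrightarrow>
          AE \<omega> in M. P \<omega> \<inter> B = {}"
    and count_indep: "\<And>B :: nat \<Rightarrow> 'p set.
          (\<And>i. B i \<in> sets borel \<and> bounded (B i) \<and> B i \<subseteq> S) \<Longrightarrow> disjoint_family B \<Longrightarrow>
          indep_vars (\<lambda>_. count_space UNIV) (\<lambda>i \<omega>. card (P \<omega> \<inter> B i)) UNIV"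

section \<open>The age-dependent random connection model\<close>

definition strip :: "(real \<times> real) set" where
  "strip = UNIV \<times> {0..1}"

text \<open>
  \<open>ad_edge \<beta> \<gamma> p q\<close> means that there is an edge from the younger vertex \<open>p\<close> to
  the older vertex \<open>q\<close>. It carries the intended meaning only for positive marks, since
  \<open>0 powr (-\<gamma>) = 0\<close>; below, every mark that matters is at least that of the root image, which
  is positive.
\<close>

fun ad_edge :: "real \<Rightarrow> real \<Rightarrow> real \<times> real \<Rightarrow> real \<times> real \<Rightarrow> bool" where
  "ad_edge \<beta> \<gamma> (y, v) (x, u) \<longleftrightarrow> u \<le> v \<and> \<bar>x - y\<bar> \<le> \<beta> * u powr (-\<gamma>) * v powr (\<gamma> - 1)"

section \<open>Trees directed towards their root\<close>

text \<open>
  A pair \<open>(i, j) \<in> E\<close> is an edge from the child \<open>i\<close> to its parent \<open>j\<close>.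
  As parents are unique, the nodes on the path from \<open>v\<close> to the root are exactly those \<open>w\<close>
  with \<open>(v, w) \<in> E\<^sup>*\<close>, and \<open>(w, w') \<in> E\<^sup>*\<close> says that \<open>w\<close> does not come after \<open>w'\<close> on this path.
\<close>

definition in_tree :: "'n set \<Rightarrow> ('n \<times> 'n) set \<Rightarrow> 'n \<Rightarrow> bool" where
  "in_tree V E r \<longleftrightarrow> finite V \<and> E \<subseteq> V \<times> V \<and> r \<in> V \<and>
     (\<forall>w. (r, w) \<notin> E) \<and> (\<forall>v\<in>V - {r}. \<exists>!w. (v, w) \<in> E) \<and> (\<forall>v\<in>V. (v, r) \<in> E\<^sup>*)"

definition leaves :: "'n set \<Rightarrow> ('n \<times> 'n) set \<Rightarrow> 'n set" where
  "leaves V E = {v \<in> V. \<forall>w. (w, v) \<notin> E}"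

definition merge_nodes :: "'n set \<Rightarrow> ('n \<times> 'n) set \<Rightarrow> 'n \<Rightarrow> 'n set" where
  "merge_nodes V E v = {w. (v, w) \<in> E\<^sup>* \<and> (\<exists>v'\<in>leaves V E - {v}. (v', w) \<in> E\<^sup>*)}"

text \<open>
  \<open>merge_nodes V E v\<close> is empty only if \<open>v\<close> is the only leaf; otherwise it contains the root.
\<close>

definition branch_end :: "'n set \<Rightarrow> ('n \<times> 'n) set \<Rightarrow> 'n \<Rightarrow> 'n \<Rightarrow> 'n" where
  "branch_end V E r v =
     (if merge_nodes V E v = {} then r
      else THE w. w \<in> merge_nodes V E v \<and> (\<forall>w'\<in>merge_nodes V E v. (w, w') \<in> E\<^sup>*))"

definition branch_length :: "'n set \<Rightarrow> ('n \<times> 'n) set \<Rightarrow> 'n \<Rightarrow> 'n \<Rightarrow> nat" where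
  "branch_length V E r v = card {w. (v, w) \<in> E\<^sup>+ \<and> (w, branch_end V E r v) \<in> E\<^sup>+}"

section \<open>Sub-tree counts\<close>

text \<open>Extensionality makes maps that agree on the nodes of the tree count only once.\<close>

definition tree_embeddings ::
  "real \<Rightarrow> real \<Rightarrow> 'n set \<Rightarrow> ('n \<times> 'n) set \<Rightarrow> 'n \<Rightarrow> (real \<times> real) set \<Rightarrow> real \<times> real
     \<Rightarrow> ('n \<Rightarrow> real \<times> real) set" where
  "tree_embeddings \<beta> \<gamma> V E r X p =
     {f \<in> V \<rightarrow>\<^sub>E insert p X. inj_on f V \<and> f r = p \<and> (\<forall>(i, j)\<in>E. ad_edge \<beta> \<gamma> (f i) (f j))}"

text \<open>
  The number of embeddings and its expectation are taken with values in \<open>[0, \<infinity>]\<close>, so that an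
  infinite value is not silently replaced by \<open>0\<close>.
\<close>

definition in_count ::
  "real \<Rightarrow> real \<Rightarrow> 'n set \<Rightarrow> ('n \<times> 'n) set \<Rightarrow> 'n \<Rightarrow> (real \<times> real) set \<Rightarrow> real \<times> real \<Rightarrow> ennreal" where
  "in_count \<beta> \<gamma> V E r X p = emeasure (count_space UNIV) (tree_embeddings \<beta> \<gamma> V E r X p)"

definition mean_in_count ::
  "'w measure \<Rightarrow> ('w \<Rightarrow> (real \<times> real) set) \<Rightarrow> real \<Rightarrow> real \<Rightarrow> 'n set \<Rightarrow> ('n \<times> 'n) set \<Rightarrow> 'n
     \<Rightarrow> real \<Rightarrow> real \<Rightarrow> ennreal" where
  "mean_in_count M P \<beta> \<gamma> V E r x u = (\<integral>\<^sup>+\<omega>. in_count \<beta> \<gamma> V E r (P \<omega>) (x, u) \<partial>M)"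

end

theory Submission
  imports Defs "HOL-Real_Asymp.Real_Asymp"
begin

text \<open>
  A mean number of copies of the tree is a mean number of tuples of distinct Poisson points that lie
  in a set. Such a mean is the Lebesgue measure of the part of the set in which all points lie in
  the strip (\<open>nn_integral_tuple_count\<close>): over products of disjoint bounded sets the
  count is a product of independent Poisson variables, and tuples of distinct points are covered by
  countably many such products.

  The Lebesgue measure of the set of embeddings is then integrated out from the leaves towards the
  root. Integrating the position of a child of mark \<open>v\<close> below a parent of mark
  \<open>u\<close> gives
  \<open>2\<beta>u\<^sup>-\<^sup>\<gamma>v\<^sup>\<gamma>\<^sup>-\<^sup>1\<close>, so that the mean
  \<open>\<Phi>\<^sub>j(u)\<close> of the subtree of a node \<open>j\<close> of mark
  \<open>u\<close> is the product over the children \<open>c\<close> of \<open>j\<close> of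
  \<open>2\<beta>u\<^sup>-\<^sup>\<gamma>\<integral>\<^sub>u\<^sup>1v\<^sup>\<gamma>\<^sup>-\<^sup>1\<Phi>\<^sub>c(v)dv\<close>
  (\<open>mean_in_count_eq\<close>). In particular the mean does not depend on the position of the
  root, and it strictly decreases in \<open>u\<close>, because the domain of integration shrinks and
  the power of \<open>u\<close> decreases.

  The asymptotics propagate up the tree along this recursion. A leaf has \<open>\<Phi> = 1\<close>
  and contributes \<open>u\<^sup>-\<^sup>\<gamma>\<close> to its parent, up to a constant. Suppose
  that \<open>\<Phi>\<^sub>c(v)\<close> behaves like
  \<open>v\<^sup>-\<^sup>k\<^sup>\<gamma>log(1/v)\<^sup>n\<close> with \<open>k \<ge> 1\<close>. If
  \<open>k \<ge> 2\<close>, the integral is dominated by its lower end, and the edge above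
  \<open>c\<close> contributes \<open>u\<^sup>-\<^sup>k\<^sup>\<gamma>log(1/u)\<^sup>n\<close>. If
  \<open>k = 1\<close>, the integrand is \<open>v\<^sup>-\<^sup>1log(1/v)\<^sup>n\<close> and the
  integral gains one more logarithm (\<open>edge_integral_asymp\<close>). Hence \<open>k\<close>
  counts the leaves below a node, and one logarithm arises at every inner node other than the root
  that has exactly one leaf below it. These are the nodes strictly between a leaf and the end of its
  branch, which gives the exponent \<open>m\<close> (\<open>sum_branch_length\<close>).
\<close>

section \<open>Means of tuple counts of a Poisson process\<close>

lemma nn_integral_poisson_pmf:
  assumes "\<mu> > 0"
  shows "(\<integral>\<^sup>+n. of_nat n \<partial>measure_pmf (poisson_pmf \<mu>)) = ennreal \<mu>"
proof -
  define h where "h n = pmf (poisson_pmf \<mu>) n * real n" for n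
  have sums: "(\<lambda>n. h (Suc n)) sums \<mu>"
  proof -
    have "(\<lambda>n. exp (-\<mu>) * \<mu> * (\<mu> ^ n /\<^sub>R fact n)) sums (exp (-\<mu>) * \<mu> * exp \<mu>)"
      by (intro sums_mult exp_converges)
    moreover have "h (Suc n) = exp (-\<mu>) * \<mu> * (\<mu> ^ n /\<^sub>R fact n)" for n
    proof -
      have "real (Suc n) / fact (Suc n) = 1 / (fact n :: real)"
        by (simp del: of_nat_Suc)
      then show ?thesis
        using assms unfolding h_def pmf_poisson[OF assms] by (simp add: field_simps del: of_nat_Suc fact_Suc)
    qed
    moreover have "exp (-\<mu>) * \<mu> * exp \<mu> = \<mu>" by (simp add: exp_minus)
    ultimately show ?thesis by simp
  qed
  then have sums0: "h sums \<mu>"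
    by (subst (asm) sums_Suc_iff) (simp add: h_def)
  have "(\<integral>\<^sup>+n. of_nat n \<partial>measure_pmf (poisson_pmf \<mu>)) =
      (\<integral>\<^sup>+n. ennreal (h n) \<partial>count_space UNIV)"
    by (simp add: nn_integral_measure_pmf h_def ennreal_mult'' flip: ennreal_of_nat_eq_real_of_nat)
  also have "\<dots> = ennreal \<mu>"
  proof -
    have "(\<Sum>n. ennreal (h n)) = ennreal (suminf h)"
    proof (rule suminf_ennreal2)
      show "summable h" using sums0 by (rule sums_summable)
    qed (simp add: h_def)
    then show ?thesis
      using sums_unique[OF sums0] by (simp only: nn_integral_count_space_nat)
  qed
  finally show ?thesis .
qed

context unit_poisson_process
begin

lemma nn_integral_card:
  assumes B: "B \<in> sets borel" "bounded B" "B \<subseteq> S"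
  shows "(\<integral>\<^sup>+\<omega>. of_nat (card (P \<omega> \<inter> B)) \<partial>M) = emeasure lborel B"
proof -
  have fin: "emeasure lborel B = ennreal (measure lborel B)"
    using emeasure_bounded_finite[OF B(2)] by (intro emeasure_eq_ennreal_measure) auto
  show ?thesis
  proof (cases "measure lborel B = 0")
    case True
    have "(\<integral>\<^sup>+\<omega>. of_nat (card (P \<omega> \<inter> B)) \<partial>M) = (\<integral>\<^sup>+\<omega>. 0 \<partial>M)"
      using count_null[OF B True] by (intro nn_integral_cong_AE) auto
    then show ?thesis using fin True by simp
  next
    case False
    then have pos: "measure lborel B > 0" by (simp add: order_less_le)
    have "(\<integral>\<^sup>+\<omega>. of_nat (card (P \<omega> \<inter> B)) \<partial>M) =
        (\<integral>\<^sup>+n. of_nat n \<partial>distr M (count_space UNIV) (\<lambda>\<omega>. card (P \<omega> \<inter> B)))"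
      using count_measurable[OF B] by (subst nn_integral_distr) auto
    also have "\<dots> = ennreal (measure lborel B)"
      unfolding count_poisson[OF B pos] by (rule nn_integral_poisson_pmf[OF pos])
    finally show ?thesis using fin by simp
  qed
qed

text \<open>
  Counting in \<open>[0, \<infinity>]\<close> through the counting measure makes the count countably
  additive in \<open>A\<close>, also where it is infinite.
\<close>

definition tuple_count :: "'i set \<Rightarrow> ('i \<Rightarrow> 'p) set \<Rightarrow> 'w \<Rightarrow> ennreal" where
  "tuple_count I A \<omega> = emeasure (count_space UNIV) {f \<in> A. inj_on f I \<and> f \<in> I \<rightarrow>\<^sub>E P \<omega>}"

lemma tuple_count_empty [simp]: "tuple_count I {} = (\<lambda>_. 0)"
  by (simp add: tuple_count_def fun_eq_iff)

lemma tuple_count_suminf: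
  assumes "disjoint_family A"
  shows "tuple_count I (\<Union>n. A n) \<omega> = (\<Sum>n. tuple_count I (A n) \<omega>)"
proof -
  let ?T = "\<lambda>B. {f \<in> B. inj_on f I \<and> f \<in> I \<rightarrow>\<^sub>E P \<omega>}"
  have "(\<Sum>n. tuple_count I (A n) \<omega>) = emeasure (count_space UNIV) (\<Union>n. ?T (A n))"
    using assms unfolding tuple_count_def
    by (intro suminf_emeasure) (auto simp: disjoint_family_on_def)
  moreover have "(\<Union>n. ?T (A n)) = ?T (\<Union>n. A n)" by blast
  ultimately show ?thesis by (simp add: tuple_count_def)
qed

text \<open>
  Disjointness of the sides makes every tuple in the box injective, so the count factorises into the
  numbers of points in the sides.
\<close>

lemma tuple_count_box_eq:
  assumes I: "finite I"
    and B: "\<And>i. i \<in> I \<Longrightarrow> B i \<in> sets borel" "\<And>i. i \<in> I \<Longrightarrow> bounded (B i)"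
    and disj: "disjoint_family_on B I"
    and \<omega>: "\<omega> \<in> space M"
  shows "tuple_count I (Pi\<^sub>E I B) \<omega> = (\<Prod>i\<in>I. of_nat (card (P \<omega> \<inter> B i)))"
proof -
  have "{f \<in> Pi\<^sub>E I B. inj_on f I \<and> f \<in> I \<rightarrow>\<^sub>E P \<omega>} = Pi\<^sub>E I (\<lambda>i. P \<omega> \<inter> B i)"
  proof (intro equalityI subsetI)
    fix f assume f: "f \<in> Pi\<^sub>E I (\<lambda>i. P \<omega> \<inter> B i)"
    then have fB: "f i \<in> B i" if "i \<in> I" for i using that by auto
    have "inj_on f I"
    proof (rule inj_onI)
      fix i j assume "i \<in> I" "j \<in> I" "f i = f j"
      then show "i = j"
        using fB[of i] fB[of j] disj by (auto simp: disjoint_family_on_def)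
    qed
    then show "f \<in> {f \<in> Pi\<^sub>E I B. inj_on f I \<and> f \<in> I \<rightarrow>\<^sub>E P \<omega>}"
      using f by (auto simp: PiE_iff)
  qed (auto simp: PiE_iff)
  moreover have "finite (Pi\<^sub>E I (\<lambda>i. P \<omega> \<inter> B i))"
    using I B(2) locally_finite[OF \<omega>] by (intro finite_PiE) auto
  ultimately show ?thesis
    using I unfolding tuple_count_def by (simp add: emeasure_count_space card_PiE)
qed

text \<open>
  The factors are independent, and the mean of each is the volume of the corresponding side.
\<close>

lemma tuple_count_box_mean:
  assumes I: "finite I" and S: "S \<in> sets borel"
    and B: "\<And>i. i \<in> I \<Longrightarrow> B i \<in> sets borel" "\<And>i. i \<in> I \<Longrightarrow> bounded (B i)"
    and disj: "disjoint_family_on B I"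
  shows "tuple_count I (Pi\<^sub>E I B) \<in> borel_measurable M"
    and "(\<integral>\<^sup>+\<omega>. tuple_count I (Pi\<^sub>E I B) \<omega> \<partial>M) =
      emeasure (Pi\<^sub>M I (\<lambda>_. lborel)) (Pi\<^sub>E I B \<inter> (I \<rightarrow>\<^sub>E S))"
proof -
  interpret L: product_sigma_finite "\<lambda>_. lborel :: 'p measure" by standard
  obtain e where e: "bij_betw e {..<card I} I"
    using ex_bij_betw_nat_finite[OF I] by (auto simp: atLeast0LessThan)
  \<comment> \<open>Independence is stated for sequences of sets, so the family is padded with empty sets.\<close>
  define B' where "B' n = (if n < card I then B (e n) \<inter> S else {})" for n
  have e_in: "e n \<in> I" if "n < card I" for n
    using e that by (auto simp: bij_betw_def)
  have B': "B' n \<in> sets borel \<and> bounded (B' n) \<and> B' n \<subseteq> S" for n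
    using B[OF e_in[of n]] S by (auto simp: B'_def bounded_Int)
  have disj': "disjoint_family B'"
  proof (unfold disjoint_family_on_def, safe)
    fix i j x assume "i \<noteq> j" and x: "x \<in> B' i" "x \<in> B' j"
    then have ij: "i < card I" "j < card I" by (auto simp: B'_def split: if_splits)
    with \<open>i \<noteq> j\<close> e have "e i \<noteq> e j" by (auto simp: bij_betw_def inj_on_def)
    then show "x \<in> {}"
      using disj x ij e_in[of i] e_in[of j] by (fastforce simp: disjoint_family_on_def B'_def)
  qed
  let ?X = "\<lambda>n \<omega>. of_nat (card (P \<omega> \<inter> B' n)) :: ennreal"
  have indep: "indep_vars (\<lambda>_. borel) ?X {..<card I}"
    using count_indep[OF B' disj']
    by (rule indep_vars_subset[OF indep_vars_compose2[where Y = "\<lambda>_. of_nat"]]) auto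
  have count: "tuple_count I (Pi\<^sub>E I B) \<omega> = (\<Prod>n<card I. ?X n \<omega>)" if \<omega>: "\<omega> \<in> space M" for \<omega>
  proof -
    have "tuple_count I (Pi\<^sub>E I B) \<omega> = (\<Prod>i\<in>I. of_nat (card (P \<omega> \<inter> B i)))"
      using tuple_count_box_eq[OF I B disj \<omega>] by simp
    also have "\<dots> = (\<Prod>n<card I. of_nat (card (P \<omega> \<inter> B (e n))))"
      by (rule prod.reindex_bij_betw[OF e, symmetric])
    also have "\<dots> = (\<Prod>n<card I. ?X n \<omega>)"
      using points_in[OF \<omega>] by (intro prod.cong refl arg_cong[where f = of_nat] arg_cong[where f = card])
        (auto simp: B'_def)
    finally show ?thesis .
  qed
  show "tuple_count I (Pi\<^sub>E I B) \<in> borel_measurable M"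
  proof (subst measurable_cong[OF count])
    have "?X n \<in> borel_measurable M" for n
      by (rule measurable_compose[OF count_measurable]) (use B' in auto)
    then show "(\<lambda>\<omega>. \<Prod>n<card I. ?X n \<omega>) \<in> borel_measurable M"
      by (intro borel_measurable_prod_ennreal)
  qed
  have "(\<integral>\<^sup>+\<omega>. tuple_count I (Pi\<^sub>E I B) \<omega> \<partial>M) = (\<integral>\<^sup>+\<omega>. (\<Prod>n<card I. ?X n \<omega>) \<partial>M)"
    by (intro nn_integral_cong count)
  also have "\<dots> = (\<Prod>n<card I. \<integral>\<^sup>+\<omega>. ?X n \<omega> \<partial>M)"
    using indep by (intro indep_vars_nn_integral) auto
  also have "\<dots> = (\<Prod>n<card I. emeasure lborel (B' n))"
    using B' by (intro prod.cong refl nn_integral_card) auto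
  also have "\<dots> = (\<Prod>n<card I. emeasure lborel (B (e n) \<inter> S))"
    by (intro prod.cong refl) (auto simp: B'_def)
  also have "\<dots> = (\<Prod>i\<in>I. emeasure lborel (B i \<inter> S))"
    by (rule prod.reindex_bij_betw[OF e])
  also have "\<dots> = emeasure (Pi\<^sub>M I (\<lambda>_. lborel)) (Pi\<^sub>E I (\<lambda>i. B i \<inter> S))"
    using B S by (intro L.emeasure_PiM[symmetric] I) auto
  also have "Pi\<^sub>E I (\<lambda>i. B i \<inter> S) = Pi\<^sub>E I B \<inter> (I \<rightarrow>\<^sub>E S)"
    by (simp add: PiE_Int)
  finally show "(\<integral>\<^sup>+\<omega>. tuple_count I (Pi\<^sub>E I B) \<omega> \<partial>M) =
      emeasure (Pi\<^sub>M I (\<lambda>_. lborel)) (Pi\<^sub>E I B \<inter> (I \<rightarrow>\<^sub>E S))" .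
qed

text \<open>
  Inside a fixed box with disjoint sides both the count and its mean are finite, so that the sets
  with the claimed mean form a Dynkin system. It contains the measurable rectangles, since the
  intersection of a rectangle with the box is again a box with disjoint bounded sides.
\<close>

lemma tuple_count_within_box:
  assumes I: "finite I" and S: "S \<in> sets borel"
    and B: "\<And>i. i \<in> I \<Longrightarrow> B i \<in> sets borel" "\<And>i. i \<in> I \<Longrightarrow> bounded (B i)"
    and disj: "disjoint_family_on B I"
    and A: "A \<in> sets (Pi\<^sub>M I (\<lambda>_. lborel))"
  shows "tuple_count I (A \<inter> Pi\<^sub>E I B) \<in> borel_measurable M \<and>
    (\<integral>\<^sup>+\<omega>. tuple_count I (A \<inter> Pi\<^sub>E I B) \<omega> \<partial>M) =
      emeasure (Pi\<^sub>M I (\<lambda>_. lborel)) (A \<inter> Pi\<^sub>E I B \<inter> (I \<rightarrow>\<^sub>E S))" (is "?good A")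
proof -
  interpret L: product_sigma_finite "\<lambda>_. lborel :: 'p measure" by standard
  let ?L = "Pi\<^sub>M I (\<lambda>_. lborel :: 'p measure)"
  let ?\<Omega> = "\<Pi>\<^sub>E i\<in>I. space (lborel :: 'p measure)"
  let ?G = "Pi\<^sub>E I B" and ?S = "I \<rightarrow>\<^sub>E S"
  have sets: "sigma_sets ?\<Omega> (prod_algebra I (\<lambda>_. lborel)) = sets ?L"
    by (rule sets_PiM[symmetric])
  have G: "?G \<in> sets ?L" and SS: "?S \<in> sets ?L"
    using I B S by (auto intro!: sets_PiM_I_finite)
  have G_fin: "tuple_count I ?G \<omega> \<noteq> \<infinity>" if "\<omega> \<in> space M" for \<omega>
    using tuple_count_box_eq[OF I B disj that] I by (simp add: ennreal_prod_eq_top)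
  have L_fin: "emeasure ?L (?G \<inter> ?S) \<noteq> \<infinity>"
  proof -
    have "emeasure ?L (?G \<inter> ?S) \<le> emeasure ?L ?G"
      using G by (intro emeasure_mono) auto
    also have "\<dots> = (\<Prod>i\<in>I. emeasure lborel (B i))"
      using B by (intro L.emeasure_PiM I) auto
    also have "\<dots> < \<infinity>"
      using emeasure_bounded_finite[OF B(2)] I by (auto simp: less_top[symmetric] ennreal_prod_eq_top)
    finally show ?thesis by simp
  qed
  have Gm: "tuple_count I ?G \<in> borel_measurable M"
    and Gi: "(\<integral>\<^sup>+\<omega>. tuple_count I ?G \<omega> \<partial>M) = emeasure ?L (?G \<inter> ?S)"
    using tuple_count_box_mean[OF I S B disj] by auto
  show ?thesis
    using Int_stable_prod_algebra prod_algebra_sets_into_space A[folded sets]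
  proof (induction rule: sigma_sets_induct_disjoint)
    case (basic A)
    then obtain X where X: "A = Pi\<^sub>E I X" "\<And>i. i \<in> I \<Longrightarrow> X i \<in> sets borel"
      by (auto simp: prod_algebra_eq_finite[OF I] Pi_iff)
    have "A \<inter> ?G = Pi\<^sub>E I (\<lambda>i. X i \<inter> B i)" unfolding X(1) by (rule PiE_Int)
    moreover have "disjoint_family_on (\<lambda>i. X i \<inter> B i) I"
      using disj by (auto simp: disjoint_family_on_def)
    ultimately show ?case
      using tuple_count_box_mean[of I "\<lambda>i. X i \<inter> B i"] I S B X(2) by (simp add: bounded_Int)
  next
    case empty
    then show ?case by simp
  next
    case (compl A)
    then have A: "A \<in> sets ?L" using sets by blast
    have split: "tuple_count I ?G \<omega> = tuple_count I (A \<inter> ?G) \<omega> + tuple_count I ((?\<Omega> - A) \<inter> ?G) \<omega>" for \<omega>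
    proof -
      let ?T = "\<lambda>C. {f \<in> C. inj_on f I \<and> f \<in> I \<rightarrow>\<^sub>E P \<omega>}"
      have "?T ?G = ?T (A \<inter> ?G) \<union> ?T ((?\<Omega> - A) \<inter> ?G)"
        by (auto simp: PiE_iff)
      then have "emeasure (count_space UNIV) (?T ?G) =
          emeasure (count_space UNIV) (?T (A \<inter> ?G) \<union> ?T ((?\<Omega> - A) \<inter> ?G))"
        by (rule arg_cong)
      also have "\<dots> = emeasure (count_space UNIV) (?T (A \<inter> ?G)) +
          emeasure (count_space UNIV) (?T ((?\<Omega> - A) \<inter> ?G))"
        by (rule plus_emeasure[symmetric]) auto
      finally show ?thesis unfolding tuple_count_def .
    qed
    have le: "tuple_count I (A \<inter> ?G) \<omega> \<le> tuple_count I ?G \<omega>" for \<omega>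
      unfolding split by simp
    have eq: "tuple_count I ((?\<Omega> - A) \<inter> ?G) \<omega> = tuple_count I ?G \<omega> - tuple_count I (A \<inter> ?G) \<omega>"
      if "\<omega> \<in> space M" for \<omega>
      using G_fin[OF that] le[of \<omega>] unfolding split by (auto simp: top_unique)
    have meas: "tuple_count I ((?\<Omega> - A) \<inter> ?G) \<in> borel_measurable M"
      using Gm compl by (subst measurable_cong[OF eq]) auto
    have "(\<integral>\<^sup>+\<omega>. tuple_count I ((?\<Omega> - A) \<inter> ?G) \<omega> \<partial>M) =
        (\<integral>\<^sup>+\<omega>. tuple_count I ?G \<omega> \<partial>M) - (\<integral>\<^sup>+\<omega>. tuple_count I (A \<inter> ?G) \<omega> \<partial>M)"
    proof -
      have "(\<integral>\<^sup>+\<omega>. tuple_count I (A \<inter> ?G) \<omega> \<partial>M) \<noteq> \<infinity>"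
        using L_fin nn_integral_mono[of M "tuple_count I (A \<inter> ?G)" "tuple_count I ?G"] le
        unfolding Gi by (auto simp: top_unique)
      then show ?thesis
        using compl Gm le eq
        by (subst nn_integral_diff[symmetric]) (auto simp del: space_lborel intro!: nn_integral_cong)
    qed
    also have "\<dots> = emeasure ?L (?G \<inter> ?S) - emeasure ?L (A \<inter> ?G \<inter> ?S)"
      using compl Gi by simp
    also have "\<dots> = emeasure ?L ((?G \<inter> ?S) - (A \<inter> ?G \<inter> ?S))"
    proof (rule emeasure_Diff[symmetric])
      have "emeasure ?L (A \<inter> ?G \<inter> ?S) \<le> emeasure ?L (?G \<inter> ?S)"
        using G SS by (intro emeasure_mono) auto
      then show "emeasure ?L (A \<inter> ?G \<inter> ?S) \<noteq> \<infinity>" using L_fin by (auto simp: top_unique)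
    qed (use A G SS in auto)
    also have "(?G \<inter> ?S) - (A \<inter> ?G \<inter> ?S) = (?\<Omega> - A) \<inter> ?G \<inter> ?S"
      by (auto simp: PiE_iff)
    finally show ?case using meas by blast
  next
    case (union A)
    then have A: "\<And>n. A n \<in> sets ?L" using sets by blast
    have disj: "disjoint_family (\<lambda>n. A n \<inter> ?G)" "disjoint_family (\<lambda>n. A n \<inter> ?G \<inter> ?S)"
      using union(1) by (auto simp: disjoint_family_on_def)
    have eq: "tuple_count I ((\<Union>n. A n) \<inter> ?G) \<omega> = (\<Sum>n. tuple_count I (A n \<inter> ?G) \<omega>)" for \<omega>
      using tuple_count_suminf[OF disj(1), of I \<omega>] by (simp add: Int_UN_distrib2)
    have "(\<integral>\<^sup>+\<omega>. tuple_count I ((\<Union>n. A n) \<inter> ?G) \<omega> \<partial>M) = (\<Sum>n. emeasure ?L (A n \<inter> ?G \<inter> ?S))"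
      unfolding eq using union(3) by (subst nn_integral_suminf) auto
    also have "\<dots> = emeasure ?L ((\<Union>n. A n) \<inter> ?G \<inter> ?S)"
      using A G SS by (subst suminf_emeasure[OF _ disj(2)]) (auto intro!: arg_cong[where f = "emeasure ?L"])
    finally show ?case
      unfolding eq[abs_def] using union(3) by (auto intro!: borel_measurable_suminf_order)
  qed
qed

end

lemma distinct_tuple_in_basis_box:
  fixes f :: "'i \<Rightarrow> 'p::metric_space"
  assumes I: "finite I" and inj: "inj_on f I" and basis: "topological_basis \<B>"
  obtains B where "\<And>i. i \<in> I \<Longrightarrow> B i \<in> \<B>" "\<And>i. i \<in> I \<Longrightarrow> bounded (B i)" "disjoint_family_on B I"
    "\<And>i. i \<in> I \<Longrightarrow> f i \<in> B i"
proof -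
  define D where "D = insert 1 ((\<lambda>(i, j). dist (f i) (f j)) ` {(i, j). i \<in> I \<and> j \<in> I \<and> i \<noteq> j})"
  have "finite {(i, j). i \<in> I \<and> j \<in> I \<and> i \<noteq> j}"
    by (rule finite_subset[of _ "I \<times> I"]) (use I in auto)
  then have D: "finite D" "D \<noteq> {}" by (auto simp: D_def)
  define \<delta> where "\<delta> = Min D"
  have "\<delta> > 0"
    unfolding \<delta>_def using D inj by (subst Min_gr_iff) (auto simp: D_def inj_on_def)
  have \<delta>: "\<delta> \<le> dist (f i) (f j)" if "i \<in> I" "j \<in> I" "i \<noteq> j" for i j
    unfolding \<delta>_def using D that by (intro Min_le) (auto simp: D_def)
  have "\<exists>b. b \<in> \<B> \<and> f i \<in> b \<and> b \<subseteq> ball (f i) (\<delta> / 2)" for i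
    using topological_basisE[OF basis open_ball, of "f i" "f i" "\<delta> / 2"] \<open>\<delta> > 0\<close>
    by (metis centre_in_ball half_gt_zero)
  then obtain B where B: "\<And>i. B i \<in> \<B>" "\<And>i. f i \<in> B i" "\<And>i. B i \<subseteq> ball (f i) (\<delta> / 2)"
    by metis
  have "disjoint_family_on B I"
  proof (unfold disjoint_family_on_def, intro ballI impI equals0I)
    fix i j z assume "i \<in> I" "j \<in> I" "i \<noteq> j" "z \<in> B i \<inter> B j"
    then have "dist (f i) z < \<delta> / 2" "dist (f j) z < \<delta> / 2" "\<delta> \<le> dist (f i) (f j)"
      using B(3)[of i] B(3)[of j] \<delta> by (auto simp: subset_iff)
    then show False using dist_triangle2[of "f i" "f j" z] by linarith
  qed
  moreover have "bounded (B i)" for i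
    using B(3)[of i] bounded_ball bounded_subset by blast
  ultimately show ?thesis using B that by blast
qed

text \<open>
  Tuples of distinct points lie in boxes with disjoint sides; the remaining tuples, on which the
  count vanishes by definition, have measure zero because each diagonal \<open>f i = f j\<close>
  has.
\<close>

lemma AE_PiM_lborel_inj_on:
  assumes I: "finite I"
  shows "AE f in Pi\<^sub>M I (\<lambda>_. lborel :: 'p::euclidean_space measure). inj_on f I"
proof -
  interpret L: product_sigma_finite "\<lambda>_. lborel :: 'p measure" by standard
  let ?L = "Pi\<^sub>M I (\<lambda>_. lborel :: 'p measure)"
  have ne: "AE f in ?L. f i \<noteq> f j" if ij: "i \<in> I" "j \<in> I" "i \<noteq> j" for i j
  proof -
    define J where "J = I - {i}"
    have J: "I = insert i J" "finite J" "i \<notin> J" "j \<in> J"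
      using ij I by (auto simp: J_def)
    have [measurable]: "(\<lambda>f. f i) \<in> ?L \<rightarrow>\<^sub>M borel" "(\<lambda>f. f j) \<in> ?L \<rightarrow>\<^sub>M borel"
      using ij measurable_component_singleton[of _ I "\<lambda>_. lborel :: 'p measure"]
      by (simp_all add: measurable_lborel1)
    have set: "{f \<in> space ?L. f i = f j} \<in> sets ?L" by measurable
    have "emeasure ?L {f \<in> space ?L. f i = f j} =
        (\<integral>\<^sup>+f. indicator {f \<in> space ?L. f i = f j} f \<partial>?L)"
      using set by simp
    also have "\<dots> = (\<integral>\<^sup>+f. (\<integral>\<^sup>+y. indicator {f \<in> space ?L. f i = f j} (f(i := y)) \<partial>lborel)
        \<partial>Pi\<^sub>M J (\<lambda>_. lborel))"
      using set unfolding J(1) by (intro L.product_nn_integral_insert J) auto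
    also have "\<dots> = (\<integral>\<^sup>+f. 0 \<partial>Pi\<^sub>M J (\<lambda>_. lborel :: 'p measure))"
    proof (intro nn_integral_cong)
      fix f
      have "(\<integral>\<^sup>+y. indicator {f \<in> space ?L. f i = f j} (f(i := y)) \<partial>lborel) \<le>
          (\<integral>\<^sup>+y. indicator {f j} y \<partial>(lborel :: 'p measure))"
        using ij(3) by (intro nn_integral_mono) (auto simp: indicator_def)
      then show "(\<integral>\<^sup>+y. indicator {f \<in> space ?L. f i = f j} (f(i := y)) \<partial>lborel) = 0" by simp
    qed
    finally show ?thesis by (intro AE_I[OF _ _ set]) auto
  qed
  have "AE f in ?L. \<forall>p\<in>{(i, j). i \<in> I \<and> j \<in> I \<and> i \<noteq> j}. f (fst p) \<noteq> f (snd p)"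
  proof (rule AE_finite_allI)
    show "finite {(i, j). i \<in> I \<and> j \<in> I \<and> i \<noteq> j}"
      by (rule finite_subset[of _ "I \<times> I"]) (use I in auto)
  qed (use ne in auto)
  then show ?thesis by eventually_elim (auto simp: inj_on_def)
qed

context unit_poisson_process
begin

text \<open>
  The multivariate Campbell formula for the factorial moment measures of a Poisson process: they are
  products of Lebesgue measure on \<open>S\<close>. The boxes with sides from a countable basis that
  are bounded and pairwise disjoint cover all tuples of distinct points. Making these countably many
  boxes disjoint cuts \<open>A\<close> into pieces each of which lies in one box.
\<close>

theorem nn_integral_tuple_count:
  assumes I: "finite I" and S: "S \<in> sets borel"
    and A: "A \<in> sets (Pi\<^sub>M I (\<lambda>_. lborel))"
  shows "(\<integral>\<^sup>+\<omega>. tuple_count I A \<omega> \<partial>M) = emeasure (Pi\<^sub>M I (\<lambda>_. lborel)) (A \<inter> (I \<rightarrow>\<^sub>E S))"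
proof -
  let ?L = "Pi\<^sub>M I (\<lambda>_. lborel :: 'p measure)"
  have SS: "(I \<rightarrow>\<^sub>E S) \<in> sets ?L"
    using I S by (auto intro!: sets_PiM_I_finite)
  obtain \<B> :: "'p set set" where \<B>: "countable \<B>" "topological_basis \<B>"
    using ex_countable_basis by blast
  define \<G> where "\<G> = {Pi\<^sub>E I B |B. B \<in> I \<rightarrow>\<^sub>E {b \<in> \<B>. bounded b} \<and> disjoint_family_on B I}"
  have "countable (I \<rightarrow>\<^sub>E {b \<in> \<B>. bounded b})"
    using \<B>(1) I by (intro countable_PiE) (auto intro: countable_subset)
  then have "countable \<G>"
    by (rule countable_subset[OF _ countable_image[where f = "Pi\<^sub>E I"], rotated]) (auto simp: \<G>_def)
  \<comment> \<open>The empty set is added only to have a nonempty family to enumerate.\<close>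
  define G where "G = from_nat_into (insert {} \<G>)"
  have G_cases: "G n = {} \<or> G n \<in> \<G>" for n
    using from_nat_into[of "insert {} \<G>" n] by (auto simp: G_def)
  have G_onto: "\<exists>n. G n = X" if "X \<in> \<G>" for X
    using \<open>countable \<G>\<close> that unfolding G_def
    by (metis countable_insert from_nat_into_surj insertI2)
  have \<B>_borel: "b \<in> sets borel" if "b \<in> \<B>" for b
    using topological_basis_open[OF \<B>(2) that] by simp
  have G_sets: "G n \<in> sets ?L" for n
  proof -
    have "X \<in> sets ?L" if "X \<in> \<G>" for X
      using that I by (fastforce simp: \<G>_def PiE_iff intro!: sets_PiM_I_finite \<B>_borel)
    then show ?thesis using G_cases[of n] by auto
  qed
  have within: "tuple_count I (A' \<inter> G n) \<in> borel_measurable M \<and>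
    (\<integral>\<^sup>+\<omega>. tuple_count I (A' \<inter> G n) \<omega> \<partial>M) = emeasure ?L (A' \<inter> G n \<inter> (I \<rightarrow>\<^sub>E S))"
    if A': "A' \<in> sets ?L" for A' n
    using G_cases[of n]
  proof
    assume "G n \<in> \<G>"
    then obtain B where B: "G n = Pi\<^sub>E I B" "B \<in> I \<rightarrow>\<^sub>E {b \<in> \<B>. bounded b}" "disjoint_family_on B I"
      by (auto simp: \<G>_def)
    show ?thesis
      unfolding B(1) using B(2) by (intro tuple_count_within_box I S B(3) A') (auto intro: \<B>_borel)
  qed simp
  define W where "W = disjointed G"
  have W: "disjoint_family W" "(\<Union>n. W n) = (\<Union>n. G n)" "\<And>n. W n \<subseteq> G n" "\<And>n. W n \<in> sets ?L"
    using G_sets sets.range_disjointed_sets[of G ?L]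
    by (auto simp: W_def disjoint_family_disjointed UN_disjointed_eq disjointed_subset)
  have cover: "f \<in> (\<Union>n. W n)" if f: "inj_on f I" "f \<in> extensional I" for f
  proof -
    obtain B where B: "\<And>i. i \<in> I \<Longrightarrow> B i \<in> \<B>" "\<And>i. i \<in> I \<Longrightarrow> bounded (B i)"
        "disjoint_family_on B I" "\<And>i. i \<in> I \<Longrightarrow> f i \<in> B i"
      using distinct_tuple_in_basis_box[OF I f(1) \<B>(2)] by blast
    have "Pi\<^sub>E I (restrict B I) \<in> \<G>"
      using B unfolding \<G>_def by (intro CollectI exI[of _ "restrict B I"]) (auto simp: disjoint_family_on_def)
    moreover have "f \<in> Pi\<^sub>E I (restrict B I)" using B(4) f(2) by (auto simp: PiE_iff extensional_def)
    ultimately obtain n where "f \<in> G n" using G_onto by metis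
    then show ?thesis unfolding W(2) by blast
  qed
  have AW: "A \<inter> W n = A \<inter> W n \<inter> G n" for n using W(3) by auto
  have disj: "disjoint_family (\<lambda>n. A \<inter> W n)" "disjoint_family (\<lambda>n. A \<inter> W n \<inter> (I \<rightarrow>\<^sub>E S))"
    using W(1) by (auto simp: disjoint_family_on_def)
  have "tuple_count I A \<omega> = (\<Sum>n. tuple_count I (A \<inter> W n) \<omega>)" for \<omega>
  proof -
    have "tuple_count I A \<omega> = tuple_count I (\<Union>n. A \<inter> W n) \<omega>"
      unfolding tuple_count_def using cover
      by (intro arg_cong[where f = "emeasure (count_space UNIV)"]) (auto simp: PiE_iff)
    then show ?thesis by (simp only: tuple_count_suminf[OF disj(1)])
  qed
  moreover have W_piece: "tuple_count I (A \<inter> W n) \<in> borel_measurable M"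
    "(\<integral>\<^sup>+\<omega>. tuple_count I (A \<inter> W n) \<omega> \<partial>M) = emeasure ?L (A \<inter> W n \<inter> (I \<rightarrow>\<^sub>E S))" for n
    using within[of "A \<inter> W n" n] A W(4) by (simp_all add: AW[symmetric])
  ultimately have "(\<integral>\<^sup>+\<omega>. tuple_count I A \<omega> \<partial>M) = (\<Sum>n. \<integral>\<^sup>+\<omega>. tuple_count I (A \<inter> W n) \<omega> \<partial>M)"
    by (simp add: nn_integral_suminf)
  also have "\<dots> = (\<Sum>n. emeasure ?L (A \<inter> W n \<inter> (I \<rightarrow>\<^sub>E S)))"
    by (simp only: W_piece(2))
  also have "\<dots> = emeasure ?L (\<Union>n. A \<inter> W n \<inter> (I \<rightarrow>\<^sub>E S))"
    using A W(4) SS by (intro suminf_emeasure disj(2)) auto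
  also have "\<dots> = emeasure ?L (A \<inter> (I \<rightarrow>\<^sub>E S))"
    by (rule emeasure_eq_AE)
      (use AE_PiM_lborel_inj_on[OF I] A W(4) SS cover in
        \<open>auto elim!: eventually_mono simp: PiE_iff\<close>)
  finally show ?thesis .
qed

end

section \<open>Integrating out the nodes of the tree\<close>

text \<open>
  This is the mean, over all in-neighbours of a vertex of mark \<open>w\<close>, of the sum of a
  weight \<open>\<phi>\<close> of their marks. The condition \<open>0 \<le> v\<close>, implied by
  \<open>w \<le> v\<close> for marks \<open>w\<close>, makes \<open>nn_integral_edge_kernel\<close>
  below hold for arbitrary real \<open>w\<close>.
\<close>

definition edge_mean :: "real \<Rightarrow> real \<Rightarrow> (real \<Rightarrow> ennreal) \<Rightarrow> real \<Rightarrow> ennreal" where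
  "edge_mean \<beta> \<gamma> \<phi> w =
     (\<integral>\<^sup>+v. (if w \<le> v \<and> 0 \<le> v \<and> v \<le> 1 then ennreal (2 * \<beta> * w powr (-\<gamma>) * v powr (\<gamma> - 1)) * \<phi> v else 0) \<partial>lborel)"

text \<open>
  This is the mean number of copies of the subtree below the node \<open>j\<close>, as a function of
  the mark \<open>u\<close> of its image. The recursion descends from a node to its children, along
  the edge relation itself.
\<close>

definition subtree_mean :: "real \<Rightarrow> real \<Rightarrow> ('n \<times> 'n) set \<Rightarrow> 'n \<Rightarrow> real \<Rightarrow> ennreal" where
  "subtree_mean \<beta> \<gamma> E = wfrec E (\<lambda>\<Phi> j u. \<Prod>c\<in>{c. (c, j) \<in> E}. edge_mean \<beta> \<gamma> (\<Phi> c) u)"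

lemma subtree_mean_rec:
  assumes "wf E"
  shows "subtree_mean \<beta> \<gamma> E j u = (\<Prod>c\<in>{c. (c, j) \<in> E}. edge_mean \<beta> \<gamma> (subtree_mean \<beta> \<gamma> E c) u)"
  unfolding subtree_mean_def
  by (subst wfrec[OF assms]) (simp add: cut_apply)

lemma measurable_edge_mean:
  assumes [measurable]: "\<phi> \<in> borel_measurable borel"
  shows "edge_mean \<beta> \<gamma> \<phi> \<in> borel_measurable borel"
  unfolding edge_mean_def[abs_def] by measurable

lemma measurable_subtree_mean:
  assumes "wf E"
  shows "subtree_mean \<beta> \<gamma> E j \<in> borel_measurable borel"
  using assms
proof (induction j rule: wf_induct_rule)
  case (less j)
  then show ?case
    unfolding subtree_mean_rec[OF assms, of \<beta> \<gamma> j, abs_def]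
    by (intro borel_measurable_prod_ennreal measurable_edge_mean) auto
qed

lemma ad_edge_iff:
  "ad_edge \<beta> \<gamma> p q \<longleftrightarrow>
     snd q \<le> snd p \<and> \<bar>fst q - fst p\<bar> \<le> \<beta> * snd q powr (-\<gamma>) * snd p powr (\<gamma> - 1)"
  by (cases p; cases q) simp

definition edge_kernel :: "real \<Rightarrow> real \<Rightarrow> real \<times> real \<Rightarrow> real \<times> real \<Rightarrow> ennreal" where
  "edge_kernel \<beta> \<gamma> p q = (if p \<in> strip \<and> ad_edge \<beta> \<gamma> p q then 1 else 0)"

lemma borel_measurable_fst: "(fst :: real \<times> real \<Rightarrow> real) \<in> borel_measurable borel"
  and borel_measurable_snd: "(snd :: real \<times> real \<Rightarrow> real) \<in> borel_measurable borel"
  by (intro borel_measurable_continuous_onI continuous_intros)+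

lemma pred_ad_edge:
  assumes f: "f \<in> borel_measurable M" and g: "g \<in> borel_measurable M"
  shows "Measurable.pred M (\<lambda>x. ad_edge \<beta> \<gamma> (f x) (g x))"
proof -
  note [measurable] = measurable_compose[OF f borel_measurable_fst]
    measurable_compose[OF f borel_measurable_snd] measurable_compose[OF g borel_measurable_fst]
    measurable_compose[OF g borel_measurable_snd]
  show ?thesis unfolding ad_edge_iff by measurable
qed

lemma strip_borel: "strip \<in> sets borel"
  unfolding strip_def by (intro borel_closed closed_Times) auto

lemma measurable_edge_kernel:
  assumes f: "f \<in> borel_measurable M" and g: "g \<in> borel_measurable M"
  shows "(\<lambda>x. edge_kernel \<beta> \<gamma> (f x) (g x)) \<in> borel_measurable M"
proof -
  note [measurable] = pred_ad_edge[OF f g] f strip_borel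
  show ?thesis unfolding edge_kernel_def by measurable
qed

text \<open>
  The position of an in-neighbour of mark \<open>v\<close> ranges over an interval of length
  \<open>2\<beta>w\<^sup>-\<^sup>\<gamma>v\<^sup>\<gamma>\<^sup>-\<^sup>1\<close> around the
  position of \<open>q\<close>, where \<open>w\<close> is the mark of \<open>q\<close>. Only this
  length enters, so the result depends on \<open>q\<close> through \<open>w\<close> alone.
\<close>

lemma nn_integral_edge_kernel:
  assumes \<beta>: "\<beta> > 0" and [measurable]: "\<phi> \<in> borel_measurable borel"
  shows "(\<integral>\<^sup>+p. edge_kernel \<beta> \<gamma> p q * \<phi> (snd p) \<partial>lborel) = edge_mean \<beta> \<gamma> \<phi> (snd q)"
proof -
  let ?\<rho> = "\<lambda>v. \<beta> * snd q powr (-\<gamma>) * v powr (\<gamma> - 1)"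
  have idm: "(\<lambda>p::real \<times> real. p) \<in> borel_measurable (lborel \<Otimes>\<^sub>M lborel)"
    by (simp add: lborel_prod)
  have meas: "(\<lambda>p. edge_kernel \<beta> \<gamma> p q * \<phi> (snd p)) \<in> borel_measurable (lborel \<Otimes>\<^sub>M lborel)"
    by (intro borel_measurable_times_ennreal measurable_edge_kernel idm) measurable
  have "(\<integral>\<^sup>+p. edge_kernel \<beta> \<gamma> p q * \<phi> (snd p) \<partial>lborel) =
      (\<integral>\<^sup>+v. \<integral>\<^sup>+y. edge_kernel \<beta> \<gamma> (y, v) q * \<phi> v \<partial>lborel \<partial>lborel)"
    using lborel_pair.nn_integral_snd[OF meas] by (simp add: lborel_prod)
  also have "\<dots> = edge_mean \<beta> \<gamma> \<phi> (snd q)"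
    unfolding edge_mean_def
  proof (intro nn_integral_cong)
    fix v :: real
    show "(\<integral>\<^sup>+y. edge_kernel \<beta> \<gamma> (y, v) q * \<phi> v \<partial>lborel) =
      (if snd q \<le> v \<and> 0 \<le> v \<and> v \<le> 1 then ennreal (2 * \<beta> * snd q powr (-\<gamma>) * v powr (\<gamma> - 1)) * \<phi> v else 0)"
    proof (cases "snd q \<le> v \<and> 0 \<le> v \<and> v \<le> 1")
      case True
      have "(\<integral>\<^sup>+y. edge_kernel \<beta> \<gamma> (y, v) q * \<phi> v \<partial>lborel) =
          (\<integral>\<^sup>+y. \<phi> v * indicator {fst q - ?\<rho> v..fst q + ?\<rho> v} y \<partial>lborel)"
        using True by (intro nn_integral_cong)
          (auto simp: edge_kernel_def ad_edge_iff strip_def indicator_def abs_le_iff)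
      also have "\<dots> = \<phi> v * ennreal (2 * ?\<rho> v)"
        using \<beta> by (simp add: nn_integral_cmult mult_ac)
      finally show ?thesis using True by (simp add: mult_ac)
    next
      case False
      then have "edge_kernel \<beta> \<gamma> (y, v) q = 0" for y
        by (auto simp: edge_kernel_def ad_edge_iff strip_def)
      then show ?thesis using False by auto
    qed
  qed
  finally show ?thesis .
qed

locale rooted_tree =
  fixes V :: "'n set" and E :: "('n \<times> 'n) set" and r :: 'n
  assumes in_tree: "in_tree V E r"
begin

definition parent :: "'n \<Rightarrow> 'n" where
  "parent i = (THE j. (i, j) \<in> E)"

abbreviation children :: "'n \<Rightarrow> 'n set" where
  "children j \<equiv> {c. (c, j) \<in> E}"

lemma finite_V: "finite V" and E_sub: "E \<subseteq> V \<times> V" and root_in: "r \<in> V"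
  and root_out: "(r, w) \<notin> E" and to_root: "v \<in> V \<Longrightarrow> (v, r) \<in> E\<^sup>*"
  using in_tree by (auto simp: in_tree_def)

lemma edge_unique: "(i, j) \<in> E \<Longrightarrow> (i, k) \<in> E \<Longrightarrow> j = k"
  using in_tree E_sub unfolding in_tree_def by blast

lemma edge_iff: "(i, j) \<in> E \<longleftrightarrow> i \<in> V - {r} \<and> parent i = j"
proof
  assume *: "(i, j) \<in> E"
  then have "parent i = j" unfolding parent_def by (blast intro: edge_unique)
  then show "i \<in> V - {r} \<and> parent i = j" using * E_sub root_out by auto
next
  assume *: "i \<in> V - {r} \<and> parent i = j"
  then obtain k where k: "(i, k) \<in> E" using in_tree unfolding in_tree_def by blast
  then have "parent i = k" unfolding parent_def by (blast intro: edge_unique)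
  then show "(i, j) \<in> E" using * k by simp
qed

lemma parent_in: "i \<in> V - {r} \<Longrightarrow> parent i \<in> V"
  using edge_iff[of i "parent i"] E_sub by auto

lemma finite_E: "finite E"
  using E_sub finite_V finite_subset by blast

text \<open>
  On a cycle through \<open>v\<close> every node has its unique outgoing edge inside the cycle, so
  the path from \<open>v\<close> to the root never leaves the cycle, although no edge starts in the
  root.
\<close>

lemma acyclic_E: "acyclic E"
proof (unfold acyclic_def, safe)
  fix v assume cyc: "(v, v) \<in> E\<^sup>+"
  have "(w, w) \<in> E\<^sup>+" if "(v, w) \<in> E\<^sup>*" for w
    using that
  proof induction
    case (step w z)
    from \<open>(w, w) \<in> E\<^sup>+\<close> obtain y where "(w, y) \<in> E" "(y, w) \<in> E\<^sup>*"
      by (meson tranclD)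
    then have "(z, w) \<in> E\<^sup>*" using edge_unique step(2) by blast
    then show ?case using step(2) by (rule rtrancl_into_trancl1)
  qed (use cyc in simp)
  moreover have "v \<in> V"
    using cyc E_sub by (auto dest: tranclD)
  ultimately have "(r, r) \<in> E\<^sup>+" using to_root by blast
  then show False using root_out by (auto dest: tranclD)
qed

lemma wf_E: "wf E"
  using finite_acyclic_wf[OF finite_E acyclic_E] .

lemma finite_children: "finite (children j)"
  using E_sub finite_V by (auto intro: finite_subset)

text \<open>
  The nodes of \<open>R\<close> are those still to be integrated over; below a boundary node the
  tree has already been integrated out and is represented by its mean.
\<close>

definition boundary :: "'n set \<Rightarrow> 'n set" where
  "boundary R = {c \<in> V - {r} - R. parent c \<in> insert r R}"

definition partial_weight ::
  "real \<Rightarrow> real \<Rightarrow> real \<times> real \<Rightarrow> 'n set \<Rightarrow> ('n \<Rightarrow> real \<times> real) \<Rightarrow> ennreal" where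
  "partial_weight \<beta> \<gamma> p R f =
     (\<Prod>i\<in>R. edge_kernel \<beta> \<gamma> (f i) ((f(r := p)) (parent i))) *
     (\<Prod>c\<in>boundary R. edge_mean \<beta> \<gamma> (subtree_mean \<beta> \<gamma> E c) (snd ((f(r := p)) (parent c))))"

lemma measurable_placement:
  assumes "i \<in> insert r R"
  shows "(\<lambda>f. (f(r := p)) i) \<in> borel_measurable (Pi\<^sub>M R (\<lambda>_. lborel :: 'b::euclidean_space measure))"
  using assms measurable_component_singleton[of i R "\<lambda>_. lborel :: 'b measure"]
  by (cases "i = r") (auto simp: measurable_lborel1)

lemma measurable_partial_weight:
  assumes R: "R \<subseteq> V - {r}" "\<And>i. i \<in> R \<Longrightarrow> parent i \<in> insert r R"
  shows "partial_weight \<beta> \<gamma> p R \<in> borel_measurable (Pi\<^sub>M R (\<lambda>_. lborel))"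
proof -
  have comp': "(\<lambda>f. f i) \<in> borel_measurable (Pi\<^sub>M R (\<lambda>_. lborel))" if "i \<in> R" for i
    using that measurable_component_singleton[of i R "\<lambda>_. lborel"] by (simp add: measurable_lborel1)
  have "(\<lambda>f. edge_mean \<beta> \<gamma> (subtree_mean \<beta> \<gamma> E c) (snd ((f(r := p)) i))) \<in> borel_measurable (Pi\<^sub>M R (\<lambda>_. lborel))"
    if "i \<in> insert r R" for i c
  proof -
    have "(\<lambda>f. snd ((f(r := p)) i)) \<in> borel_measurable (Pi\<^sub>M R (\<lambda>_. lborel))"
      using measurable_placement[OF that] borel_measurable_snd by (rule measurable_compose)
    then show ?thesis
      using measurable_edge_mean[OF measurable_subtree_mean[OF wf_E]] by (rule measurable_compose)
  qed
  then show ?thesis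
    unfolding partial_weight_def[abs_def]
    by (intro borel_measurable_times_ennreal borel_measurable_prod_ennreal measurable_edge_kernel measurable_placement comp')
      (use R(2) in \<open>auto simp: boundary_def\<close>)
qed

text \<open>
  A node \<open>v\<close> of \<open>R\<close> without children in \<open>R\<close> occurs in the
  integrand only through the edge to its parent and the means of all its children, whose product is
  its own subtree mean. Integrating over its location therefore turns \<open>v\<close> into a
  boundary node. When no node is left, the boundary consists of the children of the root.
\<close>

lemma nn_integral_partial_weight:
  assumes \<beta>: "\<beta> > 0"
    and R: "R \<subseteq> V - {r}" "\<And>i. i \<in> R \<Longrightarrow> parent i \<in> insert r R"
  shows "(\<integral>\<^sup>+f. partial_weight \<beta> \<gamma> p R f \<partial>Pi\<^sub>M R (\<lambda>_. lborel)) = subtree_mean \<beta> \<gamma> E r (snd p)"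
proof -
  interpret L: product_sigma_finite "\<lambda>_. lborel :: (real \<times> real) measure" by standard
  have "finite R" using R(1) finite_V finite_subset by blast
  then show ?thesis using R
  proof (induction R rule: finite_psubset_induct)
    case (psubset R)
    show ?case
    proof (cases "R = {}")
      case True
      have "boundary {} = children r"
        by (auto simp: boundary_def edge_iff)
      then show ?thesis
        using True unfolding subtree_mean_rec[OF wf_E, of _ _ r]
        by (auto simp: partial_weight_def PiM_empty nn_integral_count_space_finite edge_iff intro!: prod.cong)
    next
      case False
      then obtain v where v: "v \<in> R" "\<And>c. (c, v) \<in> E \<Longrightarrow> c \<notin> R"
        using wfE_min[OF wf_E] by (metis ex_in_conv)
      \<comment> \<open>As \<open>v\<close> has no child in \<open>R\<close>, \<open>R - {v}\<close> is again closed under parents, up to the root.\<close>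
      define R' where "R' = R - {v}"
      have vr: "v \<in> V - {r}" using v(1) psubset.prems(1) by blast
      have R': "R = insert v R'" "v \<notin> R'" "R' \<subseteq> V - {r}" "finite R'" "R' \<subset> R"
        using v(1) psubset.prems(1) psubset.hyps by (auto simp: R'_def)
      have par_ne: "parent i \<noteq> v" if "i \<in> R" for i
        using v(2)[of i] that psubset.prems(1) edge_iff by blast
      have par: "parent i \<in> insert r R'" if "i \<in> R" for i
        using psubset.prems(2)[OF that] par_ne[OF that] R'(1) by auto
      have bd: "boundary R = (boundary R' - {v}) \<union> children v" "(boundary R' - {v}) \<inter> children v = {}"
        and v_bd: "v \<in> boundary R'"
        using v R'(1,2) par_ne[OF v(1)] vr par[OF v(1)] 
        by (auto simp: boundary_def edge_iff)
      have fin_bd: "finite (boundary R')" using finite_V by (auto simp: boundary_def)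
      let ?em = "\<lambda>c. edge_mean \<beta> \<gamma> (subtree_mean \<beta> \<gamma> E c)"
      have step: "(\<integral>\<^sup>+y. partial_weight \<beta> \<gamma> p R (f(v := y)) \<partial>lborel) = partial_weight \<beta> \<gamma> p R' f" for f
      proof -
        let ?g = "f(r := p)"
        have g: "((f(v := y))(r := p)) i = ?g i" if "i \<noteq> v" for y i using that by auto
        have gv: "((f(v := y))(r := p)) v = y" for y using vr by auto
        have kern: "(\<Prod>i\<in>R. edge_kernel \<beta> \<gamma> ((f(v := y)) i) (((f(v := y))(r := p)) (parent i))) =
            edge_kernel \<beta> \<gamma> y (?g (parent v)) * (\<Prod>i\<in>R'. edge_kernel \<beta> \<gamma> (f i) (?g (parent i)))" for y
        proof -
          have "(\<Prod>i\<in>R'. edge_kernel \<beta> \<gamma> ((f(v := y)) i) (((f(v := y))(r := p)) (parent i))) =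
              (\<Prod>i\<in>R'. edge_kernel \<beta> \<gamma> (f i) (?g (parent i)))"
            using R'(1,2) par_ne by (intro prod.cong refl) (metis fun_upd_apply insertI2)
          then show ?thesis
            using R'(1,2,4) g[OF par_ne[OF v(1)], of y] by simp
        qed
        have bound: "(\<Prod>c\<in>boundary R. ?em c (snd (((f(v := y))(r := p)) (parent c)))) =
            (\<Prod>c\<in>boundary R' - {v}. ?em c (snd (?g (parent c)))) * subtree_mean \<beta> \<gamma> E v (snd y)" for y
        proof -
          have "(\<Prod>c\<in>boundary R' - {v}. ?em c (snd (((f(v := y))(r := p)) (parent c)))) =
              (\<Prod>c\<in>boundary R' - {v}. ?em c (snd (?g (parent c))))"
            using R'(2) vr by (intro prod.cong refl) (auto simp: boundary_def)
          moreover have "(\<Prod>c\<in>children v. ?em c (snd (((f(v := y))(r := p)) (parent c)))) =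
              subtree_mean \<beta> \<gamma> E v (snd y)"
            unfolding subtree_mean_rec[OF wf_E, of _ _ v]
            by (intro prod.cong refl) (use vr in \<open>auto simp: edge_iff\<close>)
          ultimately show ?thesis
            unfolding bd(1) using bd(2) fin_bd finite_children by (subst prod.union_disjoint) auto
        qed
        have "(\<integral>\<^sup>+y. partial_weight \<beta> \<gamma> p R (f(v := y)) \<partial>lborel) =
            (\<integral>\<^sup>+y. ((\<Prod>i\<in>R'. edge_kernel \<beta> \<gamma> (f i) (?g (parent i))) *
              (\<Prod>c\<in>boundary R' - {v}. ?em c (snd (?g (parent c))))) *
              (edge_kernel \<beta> \<gamma> y (?g (parent v)) * subtree_mean \<beta> \<gamma> E v (snd y)) \<partial>lborel)"
          unfolding partial_weight_def kern bound by (simp add: mult_ac)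
        also have "\<dots> = ((\<Prod>i\<in>R'. edge_kernel \<beta> \<gamma> (f i) (?g (parent i))) *
              (\<Prod>c\<in>boundary R' - {v}. ?em c (snd (?g (parent c))))) * ?em v (snd (?g (parent v)))"
        proof -
          have "(\<lambda>y. subtree_mean \<beta> \<gamma> E v (snd y)) \<in> borel_measurable (lborel :: (real \<times> real) measure)"
            using measurable_compose[OF borel_measurable_snd measurable_subtree_mean[OF wf_E]] by simp
          then show ?thesis
            using nn_integral_edge_kernel[OF \<beta> measurable_subtree_mean[OF wf_E]]
            by (subst nn_integral_cmult) (auto intro!: borel_measurable_times_ennreal measurable_edge_kernel)
        qed
        also have "\<dots> = partial_weight \<beta> \<gamma> p R' f"
          unfolding partial_weight_def using v_bd fin_bd by (subst (2) prod.remove[of _ v]) (auto simp: mult_ac)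
        finally show ?thesis .
      qed
      have "(\<integral>\<^sup>+f. partial_weight \<beta> \<gamma> p R f \<partial>Pi\<^sub>M R (\<lambda>_. lborel)) =
          (\<integral>\<^sup>+f. \<integral>\<^sup>+y. partial_weight \<beta> \<gamma> p R (f(v := y)) \<partial>lborel \<partial>Pi\<^sub>M R' (\<lambda>_. lborel))"
        using measurable_partial_weight[OF psubset.prems] R'(2,4) unfolding R'(1)
        by (intro L.product_nn_integral_insert) auto
      also have "\<dots> = subtree_mean \<beta> \<gamma> E r (snd p)"
        unfolding step using R'(5,3) par R'(1) by (intro psubset.IH) auto
      finally show ?thesis .
    qed
  qed
qed

text \<open>
  Almost surely the point \<open>(x, u)\<close> is not a point of the process. Then no Poisson point
  competes with the image of the root for injectivity, and embeddings of the tree correspond to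
  injective tuples of Poisson points indexed by the nodes other than the root.
\<close>

lemma mean_in_count_eq:
  assumes pp: "unit_poisson_process M strip P" and \<beta>: "\<beta> > 0" and u: "0 \<le> u" "u \<le> 1"
  shows "mean_in_count M P \<beta> \<gamma> V E r x u = subtree_mean \<beta> \<gamma> E r u"
proof -
  interpret unit_poisson_process M strip P by (rule pp)
  let ?p = "(x, u)" and ?I = "V - {r}" and ?L = "Pi\<^sub>M (V - {r}) (\<lambda>_. lborel :: (real \<times> real) measure)"
  define A where "A = {f \<in> space ?L. \<forall>i\<in>?I. ad_edge \<beta> \<gamma> (f i) ((f(r := ?p)) (parent i))}"
  have comp: "(\<lambda>f. f i) \<in> borel_measurable ?L" if "i \<in> ?I" for i
    using that measurable_component_singleton[of i ?I "\<lambda>_. lborel"] by (simp add: measurable_lborel1)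
  have A_sets: "A \<in> sets ?L"
    unfolding A_def
  proof (rule sets.sets_Collect_finite_All)
    fix i assume i: "i \<in> ?I"
    then have "parent i \<in> insert r ?I" using parent_in by blast
    then show "{f \<in> space ?L. ad_edge \<beta> \<gamma> (f i) ((f(r := ?p)) (parent i))} \<in> sets ?L"
      using pred_ad_edge[OF comp[OF i] measurable_placement] by (simp add: pred_def)
  qed (use finite_V in auto)
  have strip_sets: "(?I \<rightarrow>\<^sub>E strip) \<in> sets ?L"
    using finite_V strip_borel by (auto intro!: sets_PiM_I_finite)
  have bij: "bij_betw (\<lambda>f. restrict f ?I) (tree_embeddings \<beta> \<gamma> V E r (P \<omega>) ?p)
      {f \<in> A. inj_on f ?I \<and> f \<in> ?I \<rightarrow>\<^sub>E P \<omega>}" if p: "?p \<notin> P \<omega>" for \<omega>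
  proof (rule bij_betwI[where g = "\<lambda>f. f(r := ?p)"])
    show "(\<lambda>f. restrict f ?I) \<in> tree_embeddings \<beta> \<gamma> V E r (P \<omega>) ?p \<rightarrow>
        {f \<in> A. inj_on f ?I \<and> f \<in> ?I \<rightarrow>\<^sub>E P \<omega>}"
    proof
      fix f assume f: "f \<in> tree_embeddings \<beta> \<gamma> V E r (P \<omega>) ?p"
      then have inj: "inj_on f V" and root: "f r = ?p" and fV: "f \<in> V \<rightarrow>\<^sub>E insert ?p (P \<omega>)"
        and edge: "\<And>i j. (i, j) \<in> E \<Longrightarrow> ad_edge \<beta> \<gamma> (f i) (f j)"
        by (auto simp: tree_embeddings_def)
      have "f i \<in> P \<omega>" if i: "i \<in> ?I" for i
      proof -
        have "f i \<noteq> f r" using inj_onD[OF inj, of i r] i root_in by blast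
        then show ?thesis using fV i root by (auto simp: PiE_iff)
      qed
      then have in_P: "restrict f ?I \<in> ?I \<rightarrow>\<^sub>E P \<omega>" by auto
      have "inj_on (restrict f ?I) ?I"
        using inj by (auto simp: inj_on_def)
      have "ad_edge \<beta> \<gamma> (restrict f ?I i) (((restrict f ?I)(r := ?p)) (parent i))" if "i \<in> ?I" for i
        using edge[of i "parent i"] that parent_in[OF that] root by (auto simp: edge_iff)
      then have "restrict f ?I \<in> A"
        unfolding A_def by (intro CollectI conjI ballI) (simp add: space_PiM)
      then show "restrict f ?I \<in> {f \<in> A. inj_on f ?I \<and> f \<in> ?I \<rightarrow>\<^sub>E P \<omega>}"
        using in_P \<open>inj_on (restrict f ?I) ?I\<close> by blast
    qed
    show "(\<lambda>f. f(r := ?p)) \<in> {f \<in> A. inj_on f ?I \<and> f \<in> ?I \<rightarrow>\<^sub>E P \<omega>} \<rightarrow>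
        tree_embeddings \<beta> \<gamma> V E r (P \<omega>) ?p"
    proof
      fix f assume f: "f \<in> {f \<in> A. inj_on f ?I \<and> f \<in> ?I \<rightarrow>\<^sub>E P \<omega>}"
      then have inj: "inj_on f ?I" and fI: "\<And>i. i \<in> ?I \<Longrightarrow> f i \<in> P \<omega>" and ext: "f \<in> extensional ?I"
        and edge: "\<And>i. i \<in> ?I \<Longrightarrow> ad_edge \<beta> \<gamma> (f i) ((f(r := ?p)) (parent i))"
        by (auto simp: A_def PiE_iff)
      have "inj_on (f(r := ?p)) V"
      proof (rule inj_onI)
        fix i j assume "i \<in> V" "j \<in> V" "(f(r := ?p)) i = (f(r := ?p)) j"
        then show "i = j"
          using p inj fI[of i] fI[of j] by (auto simp: inj_on_def split: if_splits)
      qed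
      moreover have "f(r := ?p) \<in> V \<rightarrow>\<^sub>E insert ?p (P \<omega>)"
        using fI ext root_in by (auto simp: PiE_iff extensional_def)
      moreover have "ad_edge \<beta> \<gamma> ((f(r := ?p)) i) ((f(r := ?p)) j)" if "(i, j) \<in> E" for i j
        using that edge[of i] by (auto simp: edge_iff)
      ultimately show "f(r := ?p) \<in> tree_embeddings \<beta> \<gamma> V E r (P \<omega>) ?p"
        unfolding tree_embeddings_def by (intro CollectI conjI) (blast, blast, simp, blast)
    qed
    show "(restrict f ?I)(r := ?p) = f" if "f \<in> tree_embeddings \<beta> \<gamma> V E r (P \<omega>) ?p" for f
      using that by (auto simp: tree_embeddings_def fun_eq_iff PiE_iff extensional_def)
    show "restrict (f(r := ?p)) ?I = f" if "f \<in> {f \<in> A. inj_on f ?I \<and> f \<in> ?I \<rightarrow>\<^sub>E P \<omega>}" for f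
      using that by (auto simp: fun_eq_iff PiE_iff extensional_def)
  qed
  have AE_p: "AE \<omega> in M. ?p \<notin> P \<omega>"
    using count_null[of "{?p}"] u by (auto simp: strip_def)
  have "AE \<omega> in M. in_count \<beta> \<gamma> V E r (P \<omega>) ?p = tuple_count ?I A \<omega>"
    using AE_p
  proof eventually_elim
    case (elim \<omega>)
    then show ?case
      using bij_betw_same_card[OF bij[OF elim]] bij_betw_finite[OF bij[OF elim]]
      unfolding in_count_def tuple_count_def by (simp add: emeasure_count_space)
  qed
  then have "mean_in_count M P \<beta> \<gamma> V E r x u = (\<integral>\<^sup>+\<omega>. tuple_count ?I A \<omega> \<partial>M)"
    unfolding mean_in_count_def by (rule nn_integral_cong_AE)
  also have "\<dots> = emeasure ?L (A \<inter> (?I \<rightarrow>\<^sub>E strip))"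
    by (rule nn_integral_tuple_count) (use finite_V strip_borel A_sets in auto)
  also have "\<dots> = (\<integral>\<^sup>+f. indicator (A \<inter> (?I \<rightarrow>\<^sub>E strip)) f \<partial>?L)"
    using A_sets strip_sets by simp
  also have "\<dots> = (\<integral>\<^sup>+f. partial_weight \<beta> \<gamma> ?p ?I f \<partial>?L)"
  proof (intro nn_integral_cong)
    fix f assume f: "f \<in> space ?L"
    have "boundary ?I = {}" by (auto simp: boundary_def)
    then have "partial_weight \<beta> \<gamma> ?p ?I f = (\<Prod>i\<in>?I. edge_kernel \<beta> \<gamma> (f i) ((f(r := ?p)) (parent i)))"
      by (simp add: partial_weight_def)
    also have "\<dots> = indicator (A \<inter> (?I \<rightarrow>\<^sub>E strip)) f"
    proof (cases "f \<in> A \<inter> (?I \<rightarrow>\<^sub>E strip)")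
      case True
      then have "edge_kernel \<beta> \<gamma> (f i) ((f(r := ?p)) (parent i)) = 1" if "i \<in> ?I" for i
        using that by (auto simp: A_def edge_kernel_def)
      then have "(\<Prod>i\<in>?I. edge_kernel \<beta> \<gamma> (f i) ((f(r := ?p)) (parent i))) = 1" by (rule prod.neutral[OF ballI])
      then show ?thesis using True by simp
    next
      case False
      then obtain i where "i \<in> ?I" "\<not> (f i \<in> strip \<and> ad_edge \<beta> \<gamma> (f i) ((f(r := ?p)) (parent i)))"
        using f by (auto simp: A_def space_PiM PiE_iff)
      then have "\<exists>i\<in>?I. edge_kernel \<beta> \<gamma> (f i) ((f(r := ?p)) (parent i)) = 0"
        unfolding edge_kernel_def by meson
      then have "(\<Prod>i\<in>?I. edge_kernel \<beta> \<gamma> (f i) ((f(r := ?p)) (parent i))) = 0"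
        using finite_V by (intro prod_zero) auto
      then show ?thesis using False by simp
    qed
    finally show "indicator (A \<inter> (?I \<rightarrow>\<^sub>E strip)) f = partial_weight \<beta> \<gamma> ?p ?I f" ..
  qed
  also have "\<dots> = subtree_mean \<beta> \<gamma> E r u"
    using nn_integral_partial_weight[OF \<beta>, of ?I \<gamma> ?p] parent_in by auto
  finally show ?thesis .
qed

end

section \<open>Asymptotics of the integral along an edge\<close>

lemma DERIV_tail_integral:
  fixes h :: "real \<Rightarrow> real"
  assumes h: "continuous_on {0<..b} h" and u: "0 < u" "u < b"
  shows "((\<lambda>u. integral {u..b} h) has_real_derivative - h u) (at u)"
proof -
  have "((\<lambda>u. integral {u..b} h) has_real_derivative - h u) (at u within {u/2..b})"
    by (rule integral_has_real_derivative') (use u in \<open>auto intro: continuous_on_subset[OF h]\<close>)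
  moreover have "at u within {u/2..b} = at u"
    using u by (intro at_within_interior) simp
  ultimately show ?thesis by simp
qed

lemma continuous_on_tail_integral:
  fixes h :: "real \<Rightarrow> real"
  assumes h: "continuous_on {0<..b} h"
  shows "continuous_on {0<..b} (\<lambda>u. integral {u..b} h)"
proof (unfold continuous_on_eq_continuous_within, intro ballI)
  fix u assume u: "u \<in> {0<..b}"
  have "((\<lambda>u. integral {u..b} h) has_real_derivative - h u) (at u within {u/2..b})"
    by (rule integral_has_real_derivative') (use u in \<open>auto intro: continuous_on_subset[OF h]\<close>)
  then have "continuous (at u within {u/2..b}) (\<lambda>u. integral {u..b} h)"
    by (rule DERIV_continuous)
  moreover have "at u within {u/2..b} = at u within {0<..b}"
    by (rule at_within_nhd[of _ "{u/2<..}"]) (use u in auto)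
  ultimately show "continuous (at u within {0<..b}) (\<lambda>u. integral {u..b} h)" by simp
qed

lemma tail_integral_decreasing:
  fixes h :: "real \<Rightarrow> real"
  assumes h: "continuous_on {0<..b} h" and pos: "\<And>v. 0 < v \<Longrightarrow> v < b \<Longrightarrow> h v > 0"
    and u: "0 < u" "u < w" "w \<le> b"
  shows "integral {w..b} h < integral {u..b} h"
proof (rule DERIV_neg_imp_decreasing_open[OF u(2)])
  fix v assume "u < v" "v < w"
  then show "\<exists>y. DERIV (\<lambda>u. integral {u..b} h) v :> y \<and> y < 0"
    using DERIV_tail_integral[OF h, of v] pos[of v] u by auto
qed (use u in \<open>auto intro: continuous_on_subset[OF continuous_on_tail_integral[OF h]]\<close>)

text \<open>
  A form of Karamata's theorem for tail integrals at \<open>0\<close>, by l'Hopital's rule: the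
  hypotheses say that the derivatives of the two sides are equivalent and that \<open>G\<close>
  diverges.
\<close>

lemma tail_integral_asymp_equiv:
  fixes h G G' :: "real \<Rightarrow> real"
  assumes b: "b > 0" and h: "continuous_on {0<..b} h"
    and hG: "h \<sim>[at_right 0] (\<lambda>u. - G' u)"
    and G: "eventually (\<lambda>u. (G has_real_derivative G' u) (at u)) (at_right 0)"
    and G'_nz: "eventually (\<lambda>u. G' u \<noteq> 0) (at_right 0)"
    and G_top: "filterlim G at_top (at_right 0)"
  shows "(\<lambda>u. integral {u..b} h) \<sim>[at_right 0] G"
proof (rule asymp_equivI', rule lhopital_right_0_at_top[OF G_top G'_nz _ G])
  show "eventually (\<lambda>u. ((\<lambda>u. integral {u..b} h) has_real_derivative - h u) (at u)) (at_right 0)"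
    using eventually_at_right_real[OF b]
    by eventually_elim (auto intro: DERIV_tail_integral[OF h])
  have "((\<lambda>u. h u / - G' u) \<longlongrightarrow> 1) (at_right 0)"
    using hG by (rule asymp_equivD_strong) (use G'_nz in \<open>auto elim: eventually_mono\<close>)
  then show "((\<lambda>u. - h u / G' u) \<longlongrightarrow> 1) (at_right 0)" by simp
qed

lemma filterlim_ln_inverse: "filterlim (\<lambda>u::real. ln (1 / u)) at_top (at_right 0)"
  by real_asymp

lemma DERIV_ln_inverse_power:
  fixes u :: real
  assumes "u > 0"
  shows "((\<lambda>u. ln (1 / u) ^ n) has_real_derivative n * (- 1 / u * ln (1 / u) ^ (n - Suc 0))) (at u)"
proof (rule DERIV_power)
  show "((\<lambda>u. ln (1 / u)) has_real_derivative - 1 / u) (at u)"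
    using assms by (auto intro!: derivative_eq_intros simp: field_simps power2_eq_square)
qed

lemma tail_integral_log:
  fixes h :: "real \<Rightarrow> real"
  assumes h: "continuous_on {0<..1} h" and C: "C > 0"
    and asymp: "h \<sim>[at_right 0] (\<lambda>v. C * v powr (-1) * ln (1 / v) ^ m)"
  shows "(\<lambda>u. integral {u..1} h) \<sim>[at_right 0] (\<lambda>u. C / real (m + 1) * ln (1 / u) ^ (m + 1))"
proof (rule tail_integral_asymp_equiv[OF _ h])
  let ?G' = "\<lambda>u::real. - (C * u powr (-1) * ln (1 / u) ^ m)"
  show "h \<sim>[at_right 0] (\<lambda>u. - ?G' u)" using asymp by simp
  have "((\<lambda>u. C / real (m + 1) * ln (1 / u) ^ (m + 1)) has_real_derivative ?G' u) (at u)" if "u > 0" for u :: real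
  proof -
    have "((\<lambda>u. C / real (m + 1) * ln (1 / u) ^ (m + 1)) has_real_derivative
        C / real (m + 1) * (real (m + 1) * (- 1 / u * ln (1 / u) ^ m))) (at u)"
      using DERIV_cmult[OF DERIV_ln_inverse_power[OF that, of "m + 1"], of "C / real (m + 1)"]
      by (simp only: add_diff_cancel_right' One_nat_def)
    moreover have "C / k * (k * (- 1 / u * ln (1 / u) ^ m)) = ?G' u" if "k > 0" for k
      using that \<open>u > 0\<close> by (simp add: powr_minus field_simps)
    ultimately show ?thesis by (metis of_nat_0_less_iff zero_less_Suc Suc_eq_plus1)
  qed
  then show "eventually (\<lambda>u. ((\<lambda>u. C / real (m + 1) * ln (1 / u) ^ (m + 1)) has_real_derivative ?G' u) (at u)) (at_right 0)"
    by (auto intro: eventually_mono[OF eventually_at_right_less])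
  show "eventually (\<lambda>u. ?G' u \<noteq> 0) (at_right 0)"
    using eventually_at_right_real[OF zero_less_one]
    by (auto elim!: eventually_mono) (use C in auto)
  show "filterlim (\<lambda>u. C / real (m + 1) * ln (1 / u) ^ (m + 1)) at_top (at_right 0)"
    using C by (intro filterlim_tendsto_pos_mult_at_top[OF tendsto_const]
        filterlim_pow_at_top filterlim_ln_inverse) auto
qed simp

text \<open>
  The function \<open>C / s * u powr (- s) * ln (1 / u) ^ m\<close> is not an exact primitive of the
  comparison function. Its derivative carries the additional factor \<open>1 + m / (s ln (1 /
  u))\<close>, which tends to \<open>1\<close>.
\<close>

lemma tail_integral_powr_log:
  fixes h :: "real \<Rightarrow> real"
  assumes h: "continuous_on {0<..1} h" and C: "C > 0" and s: "s > 0"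
    and asymp: "h \<sim>[at_right 0] (\<lambda>v. C * v powr (- s - 1) * ln (1 / v) ^ m)"
  shows "(\<lambda>u. integral {u..1} h) \<sim>[at_right 0] (\<lambda>u. C / s * u powr (- s) * ln (1 / u) ^ m)"
proof (rule tail_integral_asymp_equiv[OF _ h])
  let ?f = "\<lambda>u::real. C * u powr (- s - 1) * ln (1 / u) ^ m"
  let ?G' = "\<lambda>u::real. - (?f u * (1 + m / s / ln (1 / u)))"
  have lim: "((\<lambda>u::real. 1 + m / s / ln (1 / u)) \<longlongrightarrow> 1) (at_right 0)"
  proof -
    have "((\<lambda>u::real. m / s / ln (1 / u)) \<longlongrightarrow> 0) (at_right 0)"
      by (intro real_tendsto_divide_at_top[OF tendsto_const] filterlim_ln_inverse)
    then show ?thesis using tendsto_add[OF tendsto_const, of _ 0 _ 1] by simp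
  qed
  have "(\<lambda>u. ?f u) \<sim>[at_right 0] (\<lambda>u. ?f u * (1 + m / s / ln (1 / u)))"
  proof (rule asymp_equiv_symI, rule asymp_equivI')
    have "eventually (\<lambda>u. ?f u * (1 + m / s / ln (1 / u)) / ?f u = 1 + m / s / ln (1 / u)) (at_right 0)"
      using eventually_at_right_real[OF zero_less_one] by (auto elim!: eventually_mono) (use C in auto)
    then show "((\<lambda>u. ?f u * (1 + m / s / ln (1 / u)) / ?f u) \<longlongrightarrow> 1) (at_right 0)"
      using lim by (simp add: tendsto_cong)
  qed
  then show "h \<sim>[at_right 0] (\<lambda>u. - ?G' u)"
    using asymp asymp_equiv_trans by fastforce
  have "((\<lambda>u. C / s * u powr (- s) * ln (1 / u) ^ m) has_real_derivative ?G' u) (at u)"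
    if "u > 0" "u < 1" for u :: real
  proof -
    have l: "ln (1 / u) > 0" using that by simp
    have "((\<lambda>u. C / s * u powr (- s) * ln (1 / u) ^ m) has_real_derivative
        C / s * ((- s * u powr (- s - 1)) * ln (1 / u) ^ m
          + (m * (- 1 / u * ln (1 / u) ^ (m - Suc 0))) * u powr (- s))) (at u)"
      using DERIV_cmult[OF DERIV_mult[OF has_real_derivative_powr[OF that(1)]
        DERIV_ln_inverse_power[OF that(1)]]] by (simp only: mult.assoc)
    moreover have "C / s * ((- s * u powr (- s - 1)) * ln (1 / u) ^ m
          + (m * (- 1 / u * ln (1 / u) ^ (m - Suc 0))) * u powr (- s)) = ?G' u"
    proof -
      have 1: "u powr (- s) * (- 1 / u) = - (u powr (- s - 1))"
        using that by (simp add: powr_diff)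
      have 2: "m * ln (1 / u) ^ (m - Suc 0) = m * (ln (1 / u) ^ m / ln (1 / u))"
        using l by (cases m) auto
      have "real m * (- 1 / u * ln (1 / u) ^ (m - Suc 0)) * u powr (- s) =
          (u powr (- s) * (- 1 / u)) * (m * ln (1 / u) ^ (m - Suc 0))" by (simp only: mult_ac)
      also have "\<dots> = - (u powr (- s - 1)) * (m * (ln (1 / u) ^ m / ln (1 / u)))"
        unfolding 1 2 ..
      finally have 3: "real m * (- 1 / u * ln (1 / u) ^ (m - Suc 0)) * u powr (- s) =
          - (u powr (- s - 1)) * (m * (ln (1 / u) ^ m / ln (1 / u)))" .
      show ?thesis by (simp only: 3) (use s l in \<open>simp add: field_simps\<close>)
    qed
    ultimately show ?thesis by simp
  qed
  then show "eventually (\<lambda>u. ((\<lambda>u. C / s * u powr (- s) * ln (1 / u) ^ m) has_real_derivative ?G' u) (at u)) (at_right 0)"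
    using eventually_at_right_real[OF zero_less_one] by (auto elim!: eventually_mono)
  have "eventually (\<lambda>u. ?G' u < 0) (at_right 0)"
    using eventually_at_right_real[OF zero_less_one]
  proof eventually_elim
    case (elim u)
    then have "ln (1 / u) > 0" by simp
    then have "?f u > 0" "1 + m / s / ln (1 / u) > 0"
      using C s elim by (auto intro!: mult_pos_pos add_pos_nonneg)
    then show ?case by (simp only: neg_less_0_iff_less mult_pos_pos)
  qed
  then show "eventually (\<lambda>u. ?G' u \<noteq> 0) (at_right 0)"
    by (rule eventually_mono) (rule less_imp_neq)
  show "filterlim (\<lambda>u. C / s * u powr (- s) * ln (1 / u) ^ m) at_top (at_right 0)"
  proof -
    have pow: "filterlim (\<lambda>u::real. C / s * u powr (- s)) at_top (at_right 0)"
      using C s by real_asymp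
    show ?thesis
    proof (cases "m = 0")
      case False
      then show ?thesis
        by (intro filterlim_at_top_mult_at_top pow filterlim_pow_at_top filterlim_ln_inverse) auto
    qed (use pow in simp)
  qed
qed simp

text \<open>
  The real-valued counterpart of \<open>edge_mean\<close>, in terms of the Henstock-Kurzweil
  integral, for which the fundamental theorem of calculus is available.
\<close>

definition edge_integral :: "real \<Rightarrow> real \<Rightarrow> (real \<Rightarrow> real) \<Rightarrow> real \<Rightarrow> real" where
  "edge_integral \<beta> \<gamma> g u = 2 * \<beta> * u powr (-\<gamma>) * integral {u..1} (\<lambda>v. v powr (\<gamma> - 1) * g v)"

lemma continuous_on_edge_integrand:
  fixes g :: "real \<Rightarrow> real"
  assumes "continuous_on {0<..1} g"
  shows "continuous_on {0<..1} (\<lambda>v. v powr (\<gamma> - 1) * g v)"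
  using assms by (intro continuous_intros) auto

lemma edge_mean_eq_edge_integral:
  assumes \<beta>: "\<beta> > 0" and g: "continuous_on {0<..1} g" "\<And>v. v \<in> {0<..1} \<Longrightarrow> 0 \<le> g v"
    and \<phi>: "\<And>v. v \<in> {0<..1} \<Longrightarrow> \<phi> v = ennreal (g v)" and u: "0 < u" "u \<le> 1"
  shows "edge_mean \<beta> \<gamma> \<phi> u = ennreal (edge_integral \<beta> \<gamma> g u)" "0 \<le> edge_integral \<beta> \<gamma> g u"
proof -
  let ?h = "\<lambda>v. v powr (\<gamma> - 1) * g v"
  have "continuous_on {u..1} ?h"
    using u by (intro continuous_on_subset[OF continuous_on_edge_integrand[OF g(1)]]) auto
  then have int: "(?h has_integral integral {u..1} ?h) {u..1}"
    by (intro integrable_integral integrable_continuous_interval)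
  have "edge_mean \<beta> \<gamma> \<phi> u =
      (\<integral>\<^sup>+v. ennreal (2 * \<beta> * u powr (-\<gamma>) * ?h v) * indicator {u..1} v \<partial>lborel)"
    unfolding edge_mean_def using \<beta> u g(2) \<phi>
    by (intro nn_integral_cong) (auto simp: indicator_def ennreal_mult[symmetric] mult_ac)
  also have "\<dots> = ennreal (edge_integral \<beta> \<gamma> g u)"
    unfolding edge_integral_def
    by (intro nn_integral_has_integral_lebesgue' has_integral_mult_right int) (use \<beta> g(2) u in auto)
  finally show "edge_mean \<beta> \<gamma> \<phi> u = ennreal (edge_integral \<beta> \<gamma> g u)" .
  show "0 \<le> edge_integral \<beta> \<gamma> g u"
    unfolding edge_integral_def using \<beta> g(2) u by (intro mult_nonneg_nonneg has_integral_nonneg[OF int]) auto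
qed

lemma continuous_on_edge_integral:
  fixes g :: "real \<Rightarrow> real"
  assumes "continuous_on {0<..1} g"
  shows "continuous_on {0<..1} (edge_integral \<beta> \<gamma> g)"
  unfolding edge_integral_def
  by (intro continuous_intros continuous_on_tail_integral continuous_on_edge_integrand[OF assms]) auto

lemma edge_integral_decreasing:
  fixes g :: "real \<Rightarrow> real"
  assumes \<beta>: "\<beta> > 0" and \<gamma>: "\<gamma> > 0" and g: "continuous_on {0<..1} g" "\<And>v. 0 < v \<Longrightarrow> v < 1 \<Longrightarrow> 0 < g v"
    and u: "0 < u" "u < w" "w \<le> 1"
  shows "edge_integral \<beta> \<gamma> g w < edge_integral \<beta> \<gamma> g u"
proof -
  let ?I = "\<lambda>u. integral {u..1} (\<lambda>v. v powr (\<gamma> - 1) * g v)"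
  have less: "?I b < ?I a" if "0 < a" "a < b" "b \<le> 1" for a b
    using g(2) that by (intro tail_integral_decreasing continuous_on_edge_integrand[OF g(1)]) auto
  have "?I w \<ge> 0" using less[of w 1] u by (cases "w = 1") auto
  moreover have "w powr (-\<gamma>) < u powr (-\<gamma>)"
    using u \<gamma> by (intro powr_less_mono2_neg) auto
  ultimately have "w powr (-\<gamma>) * ?I w < u powr (-\<gamma>) * ?I u"
    using less[of u w] u by (intro mult_strict_mono) auto
  then show ?thesis using \<beta> by (simp add: edge_integral_def mult.assoc)
qed

text \<open>
  For a leaf the integrand \<open>v powr (\<gamma> - 1)\<close> is integrable at \<open>0\<close>,
  so that the singularity comes from the prefactor alone.
\<close>

lemma edge_integral_leaf_asymp:
  assumes \<beta>: "\<beta> > 0" and \<gamma>: "0 < \<gamma>"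
  shows "edge_integral \<beta> \<gamma> (\<lambda>_. 1) \<sim>[at_right 0] (\<lambda>u. 2 * \<beta> / \<gamma> * u powr (-\<gamma>))"
proof -
  have int: "integral {u..1} (\<lambda>v. v powr (\<gamma> - 1)) = (1 - u powr \<gamma>) / \<gamma>" if u: "0 < u" "u < 1" for u
  proof (rule integral_unique)
    have "((\<lambda>v. v powr (\<gamma> - 1)) has_integral 1 powr \<gamma> / \<gamma> - u powr \<gamma> / \<gamma>) {u..1}"
    proof (rule fundamental_theorem_of_calculus)
      fix v assume "v \<in> {u..1}"
      then have "((\<lambda>v. v powr \<gamma> / \<gamma>) has_real_derivative v powr (\<gamma> - 1)) (at v within {u..1})"
        using u \<gamma> by (auto intro!: derivative_eq_intros)
      then show "((\<lambda>v. v powr \<gamma> / \<gamma>) has_vector_derivative v powr (\<gamma> - 1)) (at v within {u..1})"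
        by (simp add: has_real_derivative_iff_has_vector_derivative)
    qed (use u in auto)
    then show "((\<lambda>v. v powr (\<gamma> - 1)) has_integral (1 - u powr \<gamma>) / \<gamma>) {u..1}"
      by (simp add: diff_divide_distrib)
  qed
  have "((\<lambda>u. 1 - u powr \<gamma>) \<longlongrightarrow> 1) (at_right 0)"
    using \<gamma> by real_asymp
  moreover have "eventually (\<lambda>u. edge_integral \<beta> \<gamma> (\<lambda>_. 1) u / (2 * \<beta> / \<gamma> * u powr (-\<gamma>)) = 1 - u powr \<gamma>) (at_right 0)"
    using eventually_at_right_real[OF zero_less_one]
    by eventually_elim (use \<beta> \<gamma> in \<open>simp add: edge_integral_def int\<close>)
  ultimately show ?thesis by (intro asymp_equivI') (simp add: tendsto_cong)
qed

text \<open>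
  The integrand behaves like \<open>v powr (- s - 1)\<close> times powers of the logarithm, where
  \<open>s = (k - 1) * \<gamma>\<close>. The prefactor \<open>u powr (-\<gamma>)\<close> then
  restores the exponent \<open>k * \<gamma>\<close>. The case \<open>s = 0\<close> is the critical
  one in which the integral produces a further logarithm.
\<close>

lemma edge_integral_asymp:
  fixes g :: "real \<Rightarrow> real" and k m :: nat
  assumes \<beta>: "\<beta> > 0" and \<gamma>: "0 < \<gamma>" and g: "continuous_on {0<..1} g" and k: "k \<ge> 1" and C: "C > 0"
    and asymp: "g \<sim>[at_right 0] (\<lambda>u. C * u powr (- real k * \<gamma>) * ln (1 / u) ^ m)"
  shows "\<exists>C'>0. edge_integral \<beta> \<gamma> g \<sim>[at_right 0]
    (\<lambda>u. C' * u powr (- real k * \<gamma>) * ln (1 / u) ^ (m + (if k = 1 then 1 else 0)))"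
proof -
  let ?h = "\<lambda>v. v powr (\<gamma> - 1) * g v"
  define s where "s = (real k - 1) * \<gamma>"
  have cont: "continuous_on {0<..1} ?h" by (rule continuous_on_edge_integrand[OF g])
  have h: "?h \<sim>[at_right 0] (\<lambda>v. C * v powr (- s - 1) * ln (1 / v) ^ m)"
  proof -
    have "?h \<sim>[at_right 0] (\<lambda>v. v powr (\<gamma> - 1) * (C * v powr (- real k * \<gamma>) * ln (1 / v) ^ m))"
      by (intro asymp_equiv_mult asymp asymp_equiv_refl)
    also have "(\<lambda>v::real. v powr (\<gamma> - 1) * (C * v powr (- real k * \<gamma>) * ln (1 / v) ^ m)) =
        (\<lambda>v. C * v powr (- s - 1) * ln (1 / v) ^ m)"
    proof
      fix v :: real
      have "v powr (- s - 1) = v powr (\<gamma> - 1) * v powr (- real k * \<gamma>)"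
        unfolding powr_add[symmetric] by (rule arg_cong[where f = "(powr) v"]) (simp add: s_def algebra_simps)
      then show "v powr (\<gamma> - 1) * (C * v powr (- real k * \<gamma>) * ln (1 / v) ^ m) =
          C * v powr (- s - 1) * ln (1 / v) ^ m" by (simp add: mult_ac)
    qed
    finally show ?thesis .
  qed
  obtain D where D: "D > 0" "(\<lambda>u. integral {u..1} ?h) \<sim>[at_right 0]
      (\<lambda>u. D * u powr (- s) * ln (1 / u) ^ (m + (if k = 1 then 1 else 0)))"
  proof (cases "k = 1")
    case True
    then have "s = 0" by (simp add: s_def)
    have "(\<lambda>u. integral {u..1} ?h) \<sim>[at_right 0] (\<lambda>u. C / real (m + 1) * ln (1 / u) ^ (m + 1))"
      by (rule tail_integral_log[OF cont C]) (use h \<open>s = 0\<close> in simp)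
    then have "(\<lambda>u. integral {u..1} ?h) \<sim>[at_right 0]
        (\<lambda>u. C / real (m + 1) * u powr (- s) * ln (1 / u) ^ (m + (if k = 1 then 1 else 0)))"
    proof (rule asymp_equiv_transfer)
      show "eventually (\<lambda>u. C / real (m + 1) * ln (1 / u) ^ (m + 1) =
          C / real (m + 1) * u powr (- s) * ln (1 / u) ^ (m + (if k = 1 then 1 else 0))) (at_right 0)"
        using True \<open>s = 0\<close> by (auto intro: eventually_mono[OF eventually_at_right_less])
    qed simp
    then show ?thesis using C by (intro that[of "C / real (m + 1)"]) auto
  next
    case False
    then have s: "s > 0" using k \<gamma> by (simp add: s_def)
    show ?thesis
      using tail_integral_powr_log[OF cont C s h] False C s by (intro that[of "C / s"]) auto
  qed
  have "edge_integral \<beta> \<gamma> g \<sim>[at_right 0]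
      (\<lambda>u. 2 * \<beta> * u powr (-\<gamma>) * (D * u powr (- s) * ln (1 / u) ^ (m + (if k = 1 then 1 else 0))))"
    unfolding edge_integral_def[abs_def] by (intro asymp_equiv_mult D(2) asymp_equiv_refl)
  also have "(\<lambda>u::real. 2 * \<beta> * u powr (-\<gamma>) * (D * u powr (- s) * ln (1 / u) ^ (m + (if k = 1 then 1 else 0)))) =
      (\<lambda>u. (2 * \<beta> * D) * u powr (- real k * \<gamma>) * ln (1 / u) ^ (m + (if k = 1 then 1 else 0)))"
  proof
    fix u :: real
    have "u powr (- real k * \<gamma>) = u powr (-\<gamma>) * u powr (- s)"
      unfolding powr_add[symmetric] by (rule arg_cong[where f = "(powr) u"]) (simp add: s_def algebra_simps)
    then show "2 * \<beta> * u powr (-\<gamma>) * (D * u powr (- s) * ln (1 / u) ^ (m + (if k = 1 then 1 else 0))) =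
        (2 * \<beta> * D) * u powr (- real k * \<gamma>) * ln (1 / u) ^ (m + (if k = 1 then 1 else 0))"
      by (simp add: mult_ac)
  qed
  finally show ?thesis using \<beta> D(1) by (intro exI[of _ "2 * \<beta> * D"]) simp
qed

section \<open>Leaves and logarithms in a tree\<close>

context rooted_tree
begin

lemma single_valued_E: "single_valued E"
  by (auto simp: single_valued_def intro: edge_unique)

lemma path_linear: "(v, a) \<in> E\<^sup>* \<Longrightarrow> (v, b) \<in> E\<^sup>* \<Longrightarrow> (a, b) \<in> E\<^sup>* \<or> (b, a) \<in> E\<^sup>*"
  by (rule single_valued_confluent[OF single_valued_E])

lemma trancl_irrefl: "(v, v) \<notin> E\<^sup>+"
  using acyclic_E by (auto simp: acyclic_def)

lemma strict_ancestor: "(v, w) \<in> E\<^sup>* \<Longrightarrow> v \<noteq> w \<Longrightarrow> (v, w) \<in> E\<^sup>+"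
  by (auto simp: rtrancl_eq_or_trancl)

lemma rtrancl_in_V: "(w, j) \<in> E\<^sup>* \<Longrightarrow> j \<in> V \<Longrightarrow> w \<in> V"
  by (erule converse_rtranclE) (use E_sub in auto)

lemma leaf_iff: "j \<in> leaves V E \<longleftrightarrow> j \<in> V \<and> children j = {}"
  by (auto simp: leaves_def)

lemma leaf_no_descendant: "v \<in> leaves V E \<Longrightarrow> (w, v) \<notin> E\<^sup>+"
  by (auto simp: leaves_def elim: tranclE)

text \<open>
  By linearity of paths one of the two children would lie above the other, and hence also above
  their common parent.
\<close>

lemma subtrees_disjoint:
  assumes c: "(c, j) \<in> E" "(c', j) \<in> E" "c \<noteq> c'" and w: "(w, c) \<in> E\<^sup>*" "(w, c') \<in> E\<^sup>*"
  shows False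
proof -
  have *: False if d: "(d, j) \<in> E" "(d', j) \<in> E" "d \<noteq> d'" "(d, d') \<in> E\<^sup>*" for d d'
  proof -
    obtain z where "(d, z) \<in> E" "(z, d') \<in> E\<^sup>*"
      using strict_ancestor[OF d(4,3)] by (blast dest: tranclD)
    then have "(j, d') \<in> E\<^sup>*" using d(1) edge_unique by blast
    then have "(j, j) \<in> E\<^sup>+" using d(2) by (rule rtrancl_into_trancl1)
    then show False using trancl_irrefl by blast
  qed
  show False using path_linear[OF w] *[of c c'] *[of c' c] c by auto
qed

definition leaves_below :: "'n \<Rightarrow> 'n set" where
  "leaves_below j = {v \<in> leaves V E. (v, j) \<in> E\<^sup>*}"

text \<open>
  For these nodes the integral along the edge to the parent is critical: the mean of the subtree has
  exponent \<open>- \<gamma>\<close>, and it is not constant as for a leaf.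
\<close>

definition log_nodes :: "'n \<Rightarrow> 'n set" where
  "log_nodes j = {w. (w, j) \<in> E\<^sup>+ \<and> w \<notin> leaves V E \<and> card (leaves_below w) = 1}"

lemma finite_leaves_below: "finite (leaves_below j)"
  using finite_V by (auto simp: leaves_below_def leaves_def)

lemma finite_log_nodes: "finite (log_nodes j)"
proof (rule finite_subset[OF _ finite_V])
  show "log_nodes j \<subseteq> V" using E_sub by (auto simp: log_nodes_def dest: tranclD)
qed

lemma leaves_below_root: "leaves_below r = leaves V E"
  using to_root by (auto simp: leaves_below_def leaves_def)

lemma leaves_below_leaf: "j \<in> leaves V E \<Longrightarrow> leaves_below j = {j}"
  using leaf_no_descendant by (auto simp: leaves_below_def rtrancl_eq_or_trancl)

lemma log_nodes_leaf: "j \<in> leaves V E \<Longrightarrow> log_nodes j = {}"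
  using leaf_no_descendant by (auto simp: log_nodes_def)

lemma leaves_below_nonempty:
  assumes "j \<in> V"
  shows "card (leaves_below j) \<ge> 1"
proof -
  have "j \<in> {w. (w, j) \<in> E\<^sup>*}" by simp
  then obtain w where "w \<in> {w. (w, j) \<in> E\<^sup>*}" "\<And>y. (y, w) \<in> E \<Longrightarrow> y \<notin> {w. (w, j) \<in> E\<^sup>*}"
    by (rule wfE_min[OF wf_E]) (rule that)
  then have w: "(w, j) \<in> E\<^sup>*" "\<And>y. (y, w) \<in> E \<Longrightarrow> (y, j) \<notin> E\<^sup>*" by simp_all
  then have "w \<in> leaves V E"
    using rtrancl_in_V[OF w(1) assms] by (auto simp: leaves_def intro: converse_rtrancl_into_rtrancl)
  then have "leaves_below j \<noteq> {}" using w(1) by (auto simp: leaves_below_def)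
  then show ?thesis using finite_leaves_below[of j] by (simp add: Suc_leI card_gt_0_iff)
qed

lemma card_leaves_below_rec:
  assumes "j \<notin> leaves V E"
  shows "card (leaves_below j) = (\<Sum>c\<in>children j. card (leaves_below c))"
proof -
  have "leaves_below j = (\<Union>c\<in>children j. leaves_below c)"
  proof (intro equalityI subsetI)
    fix v assume "v \<in> leaves_below j"
    then have v: "v \<in> leaves V E" "(v, j) \<in> E\<^sup>*" by (auto simp: leaves_below_def)
    then have "(v, j) \<in> E\<^sup>+" using assms by (intro strict_ancestor) auto
    then obtain c where "(v, c) \<in> E\<^sup>*" "(c, j) \<in> E" by (blast dest: tranclD2)
    then show "v \<in> (\<Union>c\<in>children j. leaves_below c)" using v by (auto simp: leaves_below_def)
  qed (auto simp: leaves_below_def intro: rtrancl_into_rtrancl)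
  moreover have "card (\<Union>c\<in>children j. leaves_below c) = (\<Sum>c\<in>children j. card (leaves_below c))"
    using subtrees_disjoint
    by (intro card_UN_disjoint finite_children ballI impI finite_leaves_below)
      (auto simp: leaves_below_def)
  ultimately show ?thesis by simp
qed

definition log_gain :: "'n \<Rightarrow> nat" where
  "log_gain c = (if c \<notin> leaves V E \<and> card (leaves_below c) = 1 then 1 else 0)"

lemma card_log_nodes_rec:
  "card (log_nodes j) = (\<Sum>c\<in>children j. card (log_nodes c) + log_gain c)"
proof -
  define A where "A c = (if c \<notin> leaves V E \<and> card (leaves_below c) = 1 then {c} else {})" for c
  have A: "w \<in> A c \<longleftrightarrow> w = c \<and> c \<notin> leaves V E \<and> card (leaves_below c) = 1" for w c
    by (auto simp: A_def)
  have "log_nodes j = (\<Union>c\<in>children j. log_nodes c \<union> A c)"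
    unfolding set_eq_iff UN_iff Un_iff A log_nodes_def mem_Collect_eq
    by (blast elim: tranclE intro: trancl_into_trancl)
  moreover have "card (\<Union>c\<in>children j. log_nodes c \<union> A c) = (\<Sum>c\<in>children j. card (log_nodes c \<union> A c))"
  proof (intro card_UN_disjoint finite_children ballI impI)
    fix c c' assume c: "c \<in> children j" "c' \<in> children j" "c \<noteq> c'"
    have "(w, c) \<in> E\<^sup>*" if "w \<in> log_nodes c \<union> A c" for w c
      using that by (auto simp: log_nodes_def A)
    then show "(log_nodes c \<union> A c) \<inter> (log_nodes c' \<union> A c') = {}"
      using subtrees_disjoint[of c j c'] c by blast
  qed (auto simp: A_def finite_log_nodes)
  moreover have "card (log_nodes c \<union> A c) = card (log_nodes c) + log_gain c" for c
  proof -
    have "c \<notin> log_nodes c" using trancl_irrefl by (auto simp: log_nodes_def)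
    then show ?thesis using finite_log_nodes by (auto simp: A_def log_gain_def)
  qed
  ultimately show ?thesis by simp
qed

text \<open>
  The merge nodes of \<open>v\<close> form an upper segment of the path from \<open>v\<close> to the
  root. If the segment is nonempty, its lowest node is the end of the branch. If it is empty, the
  end of the branch is the root.
\<close>

lemma before_branch_end_iff:
  assumes v: "v \<in> leaves V E" and w: "(v, w) \<in> E\<^sup>+"
  shows "(w, branch_end V E r v) \<in> E\<^sup>+ \<longleftrightarrow> (w, r) \<in> E\<^sup>+ \<and> w \<notin> merge_nodes V E v"
proof (cases "merge_nodes V E v = {}")
  case True
  then show ?thesis by (simp add: branch_end_def)
next
  case False
  let ?M = "merge_nodes V E v"
  have up: "w' \<in> ?M" if "b \<in> ?M" "(b, w') \<in> E\<^sup>*" for b w'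
    using that by (auto simp: merge_nodes_def intro: rtrancl_trans)
  obtain b where b: "b \<in> ?M" "\<And>y. (y, b) \<in> E\<^sup>+ \<Longrightarrow> y \<notin> ?M"
    using False wfE_min[OF wf_trancl[OF wf_E]] by (metis ex_in_conv)
  have b_min: "(b, w') \<in> E\<^sup>*" if "w' \<in> ?M" for w'
    using path_linear[of v b w'] b that by (auto simp: merge_nodes_def rtrancl_eq_or_trancl)
  have "branch_end V E r v = b"
    unfolding branch_end_def using False
  proof (simp, intro the_equality)
    fix w assume "w \<in> ?M \<and> (\<forall>w'\<in>?M. (w, w') \<in> E\<^sup>*)"
    then show "w = b"
      using b_min[of w] b(1) acyclic_impl_antisym_rtrancl[OF acyclic_E] by (blast dest: antisymD)
  qed (use b b_min in auto)
  moreover have "(w, b) \<in> E\<^sup>+ \<longleftrightarrow> (w, r) \<in> E\<^sup>+ \<and> w \<notin> ?M"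
  proof
    assume wb: "(w, b) \<in> E\<^sup>+"
    have "b \<in> V" using wb E_sub by (auto elim: tranclE)
    then have "(w, r) \<in> E\<^sup>+" using wb to_root by (blast intro: trancl_rtrancl_trancl)
    then show "(w, r) \<in> E\<^sup>+ \<and> w \<notin> ?M" using b(2)[OF wb] by blast
  next
    assume wr: "(w, r) \<in> E\<^sup>+ \<and> w \<notin> ?M"
    have "(b, w) \<notin> E\<^sup>*" using up[OF b(1)] wr by blast
    then have "(w, b) \<in> E\<^sup>*" "w \<noteq> b"
      using path_linear[of v w b] trancl_into_rtrancl[OF w] b(1) by (auto simp: merge_nodes_def)
    then show "(w, b) \<in> E\<^sup>+" by (rule strict_ancestor)
  qed
  ultimately show ?thesis by simp
qed

lemma branch_interior_eq:
  assumes v: "v \<in> leaves V E"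
  shows "{w. (v, w) \<in> E\<^sup>+ \<and> (w, branch_end V E r v) \<in> E\<^sup>+} = {w \<in> log_nodes r. leaves_below w = {v}}"
proof (intro set_eqI iffI)
  fix w assume "w \<in> {w. (v, w) \<in> E\<^sup>+ \<and> (w, branch_end V E r v) \<in> E\<^sup>+}"
  then have vw: "(v, w) \<in> E\<^sup>+" and "(w, branch_end V E r v) \<in> E\<^sup>+" by auto
  then have wr: "(w, r) \<in> E\<^sup>+" and "w \<notin> merge_nodes V E v"
    using before_branch_end_iff[OF v vw] by auto
  then have "leaves_below w = {v}"
    using trancl_into_rtrancl[OF vw] v by (auto simp: merge_nodes_def leaves_below_def)
  moreover have "w \<notin> leaves V E" using vw leaf_no_descendant by blast
  ultimately show "w \<in> {w \<in> log_nodes r. leaves_below w = {v}}"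
    using wr by (simp add: log_nodes_def)
next
  fix w assume "w \<in> {w \<in> log_nodes r. leaves_below w = {v}}"
  then have wr: "(w, r) \<in> E\<^sup>+" and "w \<notin> leaves V E" and L: "leaves_below w = {v}"
    by (auto simp: log_nodes_def)
  have "(v, w) \<in> E\<^sup>*" using L by (auto simp: leaves_below_def)
  then have vw: "(v, w) \<in> E\<^sup>+" using v \<open>w \<notin> leaves V E\<close> by (intro strict_ancestor) auto
  moreover have "w \<notin> merge_nodes V E v" using L by (auto simp: merge_nodes_def leaves_below_def)
  ultimately show "w \<in> {w. (v, w) \<in> E\<^sup>+ \<and> (w, branch_end V E r v) \<in> E\<^sup>+}"
    using before_branch_end_iff[OF v vw] wr by blast
qed

text \<open>
  The interior nodes of the branch of \<open>v\<close> are those logarithmic nodes whose only leaf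
  is \<open>v\<close>, so the branches partition the logarithmic nodes of the whole tree.
\<close>

lemma sum_branch_length: "(\<Sum>v\<in>leaves V E. branch_length V E r v) = card (log_nodes r)"
proof -
  have fin: "finite (leaves V E)" using finite_V by (simp add: leaves_def)
  have "log_nodes r = (\<Union>v\<in>leaves V E. {w \<in> log_nodes r. leaves_below w = {v}})"
    by (auto simp: log_nodes_def leaves_below_def card_1_singleton_iff)
  also have "card \<dots> = (\<Sum>v\<in>leaves V E. card {w \<in> log_nodes r. leaves_below w = {v}})"
    using fin finite_log_nodes by (intro card_UN_disjoint) auto
  also have "\<dots> = (\<Sum>v\<in>leaves V E. branch_length V E r v)"
    by (intro sum.cong refl) (simp add: branch_length_def branch_interior_eq)
  finally show ?thesis ..
qed

end

section \<open>Asymptotics and monotonicity of the mean\<close>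

lemma asymp_equiv_prod:
  fixes f g :: "'i \<Rightarrow> 'a \<Rightarrow> real"
  assumes "\<And>i. i \<in> A \<Longrightarrow> f i \<sim>[F] g i"
  shows "(\<lambda>x. \<Prod>i\<in>A. f i x) \<sim>[F] (\<lambda>x. \<Prod>i\<in>A. g i x)"
  using assms
  by (induction A rule: infinite_finite_induct) (auto intro!: asymp_equiv_mult)

context rooted_tree
begin

text \<open>
  All properties of the subtree means that the recursion needs from the children: continuity for
  l'Hopital's rule, positivity for strict monotonicity, and the asymptotics. At \<open>u = 1\<close>
  the mean of an inner node vanishes, so positivity holds on the open interval only. A leaf is
  treated separately because its mean is constant.
\<close>

lemma subtree_mean_profile:
  assumes \<beta>: "\<beta> > 0" and \<gamma>: "0 < \<gamma>" and j: "j \<in> V"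
  shows "\<exists>g. continuous_on {0<..1} g \<and> (\<forall>u. 0 < u \<and> u < 1 \<longrightarrow> 0 < g u) \<and>
    (\<forall>u\<in>{0<..1}. 0 \<le> g u \<and> subtree_mean \<beta> \<gamma> E j u = ennreal (g u)) \<and>
    (if j \<in> leaves V E then g = (\<lambda>_. 1) else
      (\<forall>u w. 0 < u \<and> u < w \<and> w \<le> 1 \<longrightarrow> g w < g u) \<and>
      (\<exists>C>0. g \<sim>[at_right 0]
        (\<lambda>u. C * u powr (- real (card (leaves_below j)) * \<gamma>) * ln (1 / u) ^ card (log_nodes j))))"
    (is "\<exists>g. ?profile j g")
  using j
proof (induction j rule: wf_induct_rule[OF wf_E])
  case (1 j)
  show ?case
  proof (cases "j \<in> leaves V E")
    case True
    then have "subtree_mean \<beta> \<gamma> E j u = 1" for u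
      unfolding subtree_mean_rec[OF wf_E, of _ _ j] by (simp add: leaf_iff)
    then show ?thesis using True by (intro exI[of _ "\<lambda>_. 1"]) auto
  next
    case False
    then have ne: "children j \<noteq> {}" using "1.prems" by (simp add: leaf_iff)
    have inV: "c \<in> V" if "c \<in> children j" for c using that E_sub by auto
    have "\<forall>c\<in>children j. \<exists>g. ?profile c g" using "1.IH" inV by blast
    then obtain g where g: "\<And>c. c \<in> children j \<Longrightarrow> ?profile c (g c)"
      using bchoice[of "children j" "\<lambda>c g. ?profile c g"] by blast
    let ?T = "\<lambda>c. edge_integral \<beta> \<gamma> (g c)"
    have cont: "continuous_on {0<..1} (g c)" and pos: "\<And>u. 0 < u \<Longrightarrow> u < 1 \<Longrightarrow> 0 < g c u"
      and nonneg: "\<And>u. u \<in> {0<..1} \<Longrightarrow> 0 \<le> g c u"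
      and eq: "\<And>u. u \<in> {0<..1} \<Longrightarrow> subtree_mean \<beta> \<gamma> E c u = ennreal (g c u)" if "c \<in> children j" for c
      using g[OF that] by auto
    have T_eq: "edge_mean \<beta> \<gamma> (subtree_mean \<beta> \<gamma> E c) u = ennreal (?T c u)"
      and T_nonneg: "0 \<le> ?T c u" if "c \<in> children j" "u \<in> {0<..1}" for c u
      using edge_mean_eq_edge_integral[OF \<beta> cont nonneg eq, of c u] that by auto
    have T_less: "?T c w < ?T c u" if "c \<in> children j" "0 < u" "u < w" "w \<le> 1" for c u w
      using edge_integral_decreasing[OF \<beta> \<gamma> cont pos] that by auto
    have T_pos: "0 < ?T c u" if "c \<in> children j" "0 < u" "u < 1" for c u
      using T_less[of c u 1] T_nonneg[of c 1] that by auto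
    have T_asymp: "\<exists>C>0. ?T c \<sim>[at_right 0] (\<lambda>u. C * u powr (- real (card (leaves_below c)) * \<gamma>) *
        ln (1 / u) ^ (card (log_nodes c) + log_gain c))" if c: "c \<in> children j" for c
    proof (cases "c \<in> leaves V E")
      case True
      then have "g c = (\<lambda>_. 1)" using g[OF c] by simp
      then show ?thesis
        using edge_integral_leaf_asymp[OF \<beta> \<gamma>] \<beta> \<gamma> True
        by (intro exI[of _ "2 * \<beta> / \<gamma>"]) (simp add: leaves_below_leaf log_nodes_leaf log_gain_def)
    next
      case False
      then obtain C where "C > 0" "g c \<sim>[at_right 0]
          (\<lambda>u. C * u powr (- real (card (leaves_below c)) * \<gamma>) * ln (1 / u) ^ card (log_nodes c))"
        using g[OF c] by auto
      from edge_integral_asymp[OF \<beta> \<gamma> cont[OF c] leaves_below_nonempty[OF inV[OF c]] this] False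
      show ?thesis by (simp add: log_gain_def)
    qed
    then have "\<forall>c\<in>children j. \<exists>C>0. ?T c \<sim>[at_right 0] (\<lambda>u. C * u powr (- real (card (leaves_below c)) * \<gamma>) *
        ln (1 / u) ^ (card (log_nodes c) + log_gain c))" by (rule ballI)
    from bchoice[OF this] obtain C where C: "\<And>c. c \<in> children j \<Longrightarrow> C c > 0"
      "\<And>c. c \<in> children j \<Longrightarrow> ?T c \<sim>[at_right 0] (\<lambda>u. C c * u powr (- real (card (leaves_below c)) * \<gamma>) *
        ln (1 / u) ^ (card (log_nodes c) + log_gain c))" by auto
    define G where "G u = (\<Prod>c\<in>children j. ?T c u)" for u
    have "continuous_on {0<..1} G"
      unfolding G_def by (intro continuous_on_prod continuous_on_edge_integral cont)
    moreover have "0 < G u" if "0 < u" "u < 1" for u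
      unfolding G_def using that by (intro prod_pos T_pos) auto
    moreover have "0 \<le> G u" "subtree_mean \<beta> \<gamma> E j u = ennreal (G u)" if u: "u \<in> {0<..1}" for u
    proof -
      show "0 \<le> G u" unfolding G_def using T_nonneg u by (intro prod_nonneg) auto
      have "subtree_mean \<beta> \<gamma> E j u = (\<Prod>c\<in>children j. ennreal (?T c u))"
        unfolding subtree_mean_rec[OF wf_E, of _ _ j] using T_eq u by (intro prod.cong) auto
      also have "\<dots> = ennreal (G u)"
        unfolding G_def using T_nonneg u by (intro prod_ennreal) auto
      finally show "subtree_mean \<beta> \<gamma> E j u = ennreal (G u)" .
    qed
    moreover have "G w < G u" if u: "0 < u" "u < w" "w \<le> 1" for u w
    proof -
      obtain c where "c \<in> children j" using ne by blast
      then show ?thesis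
        unfolding G_def using u T_less T_nonneg T_pos finite_children
        by (intro prod_mono_strict[of c]) (auto intro: less_imp_le)
    qed
    moreover have "G \<sim>[at_right 0] (\<lambda>u. (\<Prod>c\<in>children j. C c) *
        u powr (- real (card (leaves_below j)) * \<gamma>) * ln (1 / u) ^ card (log_nodes j))"
    proof (rule asymp_equiv_transfer)
      show "(\<lambda>u. \<Prod>c\<in>children j. ?T c u) \<sim>[at_right 0]
          (\<lambda>u. \<Prod>c\<in>children j. C c * u powr (- real (card (leaves_below c)) * \<gamma>) *
            ln (1 / u) ^ (card (log_nodes c) + log_gain c))"
        by (intro asymp_equiv_prod C(2))
      show "eventually (\<lambda>u. (\<Prod>c\<in>children j. C c * u powr (- real (card (leaves_below c)) * \<gamma>) *
            ln (1 / u) ^ (card (log_nodes c) + log_gain c)) =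
          (\<Prod>c\<in>children j. C c) * u powr (- real (card (leaves_below j)) * \<gamma>) *
            ln (1 / u) ^ card (log_nodes j)) (at_right 0)"
        using eventually_at_right_less
      proof (rule eventually_mono)
        fix u :: real assume "0 < u"
        then have "u powr (- real (card (leaves_below j)) * \<gamma>) =
            (\<Prod>c\<in>children j. u powr (- real (card (leaves_below c)) * \<gamma>))"
          using finite_children ne card_leaves_below_rec[OF False]
          by (simp add: powr_sum sum_distrib_right flip: sum_negf)
        moreover have "ln (1 / u) ^ card (log_nodes j) =
            (\<Prod>c\<in>children j. ln (1 / u) ^ (card (log_nodes c) + log_gain c))"
          unfolding card_log_nodes_rec[of j] by (rule power_sum)
        ultimately show "(\<Prod>c\<in>children j. C c * u powr (- real (card (leaves_below c)) * \<gamma>) *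
            ln (1 / u) ^ (card (log_nodes c) + log_gain c)) =
          (\<Prod>c\<in>children j. C c) * u powr (- real (card (leaves_below j)) * \<gamma>) *
            ln (1 / u) ^ card (log_nodes j)"
          by (simp only: prod.distrib)
      qed
    qed (simp add: G_def)
    moreover have "(\<Prod>c\<in>children j. C c) > 0" using C(1) by (intro prod_pos) auto
    ultimately show ?thesis using False by (intro exI[of _ G]) auto
  qed
qed

end

theorem proposition2p1:
  fixes M :: "'w measure" and P :: "'w \<Rightarrow> (real \<times> real) set"
    and V :: "'n set" and E :: "('n \<times> 'n) set" and r :: 'n
    and \<beta> \<gamma> :: real and a l m :: nat
  assumes "unit_poisson_process M strip P"
    and "\<beta> > 0" and "0 < \<gamma>" and "\<gamma> < 1"
    and "in_tree V E r" and "card V = a + 1" and "a \<ge> 1"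
    and "l = card (leaves V E)"
    and "m = (\<Sum>v\<in>leaves V E. branch_length V E r v)"
  shows "\<exists>C>0. \<forall>x.
      (\<lambda>u. enn2real (mean_in_count M P \<beta> \<gamma> V E r x u))
        \<sim>[at_right 0] (\<lambda>u. C * u powr (- real l * \<gamma>) * ln (1 / u) ^ m) \<and>
      strict_antimono_on {0<..1} (mean_in_count M P \<beta> \<gamma> V E r x)"
proof -
  interpret rooted_tree V E r using assms(5) by unfold_locales
  have "r \<notin> leaves V E"
  proof
    assume "r \<in> leaves V E"
    have "v = r" if "v \<in> V" for v
      using to_root[OF that] leaf_no_descendant[OF \<open>r \<in> leaves V E\<close>] by (auto simp: rtrancl_eq_or_trancl)
    then have "V = {r}" using root_in by blast
    then show False using assms(6,7) by simp
  qed
  with subtree_mean_profile[OF assms(2,3) root_in] obtain g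
    where g: "\<forall>u\<in>{0<..1}. 0 \<le> g u \<and> subtree_mean \<beta> \<gamma> E r u = ennreal (g u)"
      "\<forall>u w. 0 < u \<and> u < w \<and> w \<le> 1 \<longrightarrow> g w < g u"
      "\<exists>C>0. g \<sim>[at_right 0]
        (\<lambda>u. C * u powr (- real (card (leaves_below r)) * \<gamma>) * ln (1 / u) ^ card (log_nodes r))"
    by (simp only: if_False) blast
  then obtain C where nonneg: "\<And>u. u \<in> {0<..1} \<Longrightarrow> 0 \<le> g u"
    and eq: "\<And>u. u \<in> {0<..1} \<Longrightarrow> subtree_mean \<beta> \<gamma> E r u = ennreal (g u)"
    and dec: "\<And>u w. 0 < u \<Longrightarrow> u < w \<Longrightarrow> w \<le> 1 \<Longrightarrow> g w < g u"
    and C: "C > 0" and asymp: "g \<sim>[at_right 0]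
      (\<lambda>u. C * u powr (- real (card (leaves_below r)) * \<gamma>) * ln (1 / u) ^ card (log_nodes r))"
    by blast
  have mean: "mean_in_count M P \<beta> \<gamma> V E r x u = ennreal (g u)" if "u \<in> {0<..1}" for x u
    using mean_in_count_eq[OF assms(1,2), of u] eq that by simp
  have lm: "l = card (leaves_below r)" "m = card (log_nodes r)"
    using assms(8,9) leaves_below_root sum_branch_length by auto
  show ?thesis
  proof (intro exI[of _ C] conjI C allI)
    fix x
    show "(\<lambda>u. enn2real (mean_in_count M P \<beta> \<gamma> V E r x u))
        \<sim>[at_right 0] (\<lambda>u. C * u powr (- real l * \<gamma>) * ln (1 / u) ^ m)"
      using asymp unfolding lm
    proof (rule asymp_equiv_transfer)
      show "eventually (\<lambda>u. g u = enn2real (mean_in_count M P \<beta> \<gamma> V E r x u)) (at_right 0)"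
        using eventually_at_right_real[OF zero_less_one]
        by eventually_elim (use mean nonneg in auto)
    qed simp
    show "strict_antimono_on {0<..1} (mean_in_count M P \<beta> \<gamma> V E r x)"
      using mean nonneg dec by (auto simp: monotone_on_def ennreal_less_iff)
  qed
qed

end
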